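(* Let $\Gamma$ be a non-elementary hyperbolic group, let $X$ be a Gromov-hyperbolic, proper, geodesic metric space and $G=\mathrm{Isom}(X)$, and let $A$ be a characteristic subgroup of $\Gamma$. A representation $\rho\in\mathrm{Hom}(\Gamma,G)$ is $A$-stable if and only if it is $A$-well-displacing.
   Context: Fix a finite generating set $S$ of $\Gamma$, Cayley graph $C_S(\Gamma)$ with word metric $d_S$; $l_S(\gamma)=\inf_{y\in C_S(\Gamma)}d_S(y,\gamma y)$ is the translation length of $\gamma$, and for $g\in G$, $l(g)=\inf_{x\in X}d(x,gx)$. Non-elementary means $\Gamma$ contains a free subgroup of rank 2. For $\rho$ and $x\in X$, the orbit map $\tau_{\rho,x}:C_S(\Gamma)\to X$ is the $\rho$-equivariant map with $\tau_{\rho,x}(\gamma)=\rho(\gamma)(x)$ on vertices and sending edges to geodesic segments. A $(K,C)$ quasi-geodesic is the image of a map $f$ from $\mathbb{Z}$ or $\mathbb{R}$ with $\frac1K|s-t|-C\leqslant d(f(s),f(t))\leqslant K|s-t|+C$. For infinite order $a\in\Gamma$, $L_S(a)$ is the set of geodesics of $C_S(\Gamma)$ joining the two fixed points $a^-,a^+\in\partial C_S(\Gamma)$ of $a$; $L_S(A)$ is the union of $L_S(a)$ over infinite order $a\in A$. $\rho$ is $A$-stable if there are $K\geqslant1$, $C\geqslant0$, $x\in X$ such that $\tau_{\rho,x}$ maps every geodesic of $L_S(A)$ to a $(K,C)$ quasi-geodesic. $\rho$ is $A$-well-displacing if there are $J\geqslant1$, $B\geqslant0$ with $\frac1J l_S(a)-B\leqslant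 l(\rho(a))\leqslant Jl_S(a)+B$ for all $a\in A$. *)

theory Defs
  imports "HOL-Analysis.Analysis" "HOL-Algebra.Group" "HOL-Algebra.Coset" "HOL-Algebra.Generated_Groups"
begin

definition eval_word :: "('g, 'b) monoid_scheme \<Rightarrow> ('g \<times> bool) list \<Rightarrow> 'g" where
  "eval_word G w = foldr (\<lambda>(s, b) r. (if b then s else inv\<^bsub>G\<^esub> s) \<otimes>\<^bsub>G\<^esub> r) w \<one>\<^bsub>G\<^esub>"

definition word_length :: "('g, 'b) monoid_scheme \<Rightarrow> 'g set \<Rightarrow> 'g \<Rightarrow> nat" where
  "word_length G S g = (LEAST n. \<exists>w. length w = n \<and> set (map fst w) \<subseteq> S \<and> eval_word G w = g)"

definition word_dist :: "('g, 'b) monoid_scheme \<Rightarrow> 'g set \<Rightarrow> 'g \<Rightarrow> 'g \<Rightarrow> real" where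
  "word_dist G S g h = real (word_length G S (inv\<^bsub>G\<^esub> g \<otimes>\<^bsub>G\<^esub> h))"

text \<open>Geometric realisation of the Cayley graph C_S(G): a point (g, s, t) with s \<in> S and
  0 \<le> t \<le> 1 is the point at distance t from g on the (unit length) edge from g to g s.
  The vertex g is also represented as (g, \<one>, 0).\<close>
definition cayley_points :: "('g, 'b) monoid_scheme \<Rightarrow> 'g set \<Rightarrow> ('g \<times> 'g \<times> real) set" where
  "cayley_points G S =
     {(g, s, t). g \<in> carrier G \<and> s \<in> S \<and> 0 \<le> t \<and> t \<le> 1} \<union> {(g, \<one>\<^bsub>G\<^esub>, 0) | g. g \<in> carrier G}"

definition cayley_vertex :: "('g, 'b) monoid_scheme \<Rightarrow> 'g \<Rightarrow> 'g \<times> 'g \<times> real" where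
  "cayley_vertex G g = (g, \<one>\<^bsub>G\<^esub>, 0)"

definition cayley_ends :: "('g, 'b) monoid_scheme \<Rightarrow> 'g \<times> 'g \<times> real \<Rightarrow> ('g \<times> real) set" where
  "cayley_ends G p = (case p of (g, s, t) \<Rightarrow> {(g, t), (g \<otimes>\<^bsub>G\<^esub> s, 1 - t)})"

text \<open>Path metric of the Cayley graph (all edges of length 1): either the two points lie on
  the same edge and are joined along it, or a shortest path leaves through an endpoint of
  one edge and enters through an endpoint of the other.\<close>
definition cayley_dist :: "('g, 'b) monoid_scheme \<Rightarrow> 'g set \<Rightarrow> 'g \<times> 'g \<times> real \<Rightarrow> 'g \<times> 'g \<times> real \<Rightarrow> real" where
  "cayley_dist G S p q =
     Min ({a + word_dist G S u v + b | u a v b. (u, a) \<in> cayley_ends G p \<and> (v, b) \<in> cayley_ends G q}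
          \<union> (if fst p = fst q \<and> fst (snd p) = fst (snd q) then {\<bar>snd (snd p) - snd (snd q)\<bar>} else {}))"

definition cayley_act :: "('g, 'b) monoid_scheme \<Rightarrow> 'g \<Rightarrow> 'g \<times> 'g \<times> real \<Rightarrow> 'g \<times> 'g \<times> real" where
  "cayley_act G \<gamma> p = (case p of (g, s, t) \<Rightarrow> (\<gamma> \<otimes>\<^bsub>G\<^esub> g, s, t))"

definition trans_length_S :: "('g, 'b) monoid_scheme \<Rightarrow> 'g set \<Rightarrow> 'g \<Rightarrow> real" where
  "trans_length_S G S \<gamma> = Inf {cayley_dist G S y (cayley_act G \<gamma> y) | y. y \<in> cayley_points G S}"

definition gromov_prod :: "('p \<Rightarrow> 'p \<Rightarrow> real) \<Rightarrow> 'p \<Rightarrow> 'p \<Rightarrow> 'p \<Rightarrow> real" where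
  "gromov_prod d w x y = (d x w + d y w - d x y) / 2"

definition gromov_hyperbolic_on :: "'p set \<Rightarrow> ('p \<Rightarrow> 'p \<Rightarrow> real) \<Rightarrow> bool" where
  "gromov_hyperbolic_on P d \<longleftrightarrow> (\<exists>\<delta>\<ge>0. \<forall>w\<in>P. \<forall>x\<in>P. \<forall>y\<in>P. \<forall>z\<in>P.
      gromov_prod d w x z \<ge> min (gromov_prod d w x y) (gromov_prod d w y z) - \<delta>)"

definition hyperbolic_group :: "('g, 'b) monoid_scheme \<Rightarrow> 'g set \<Rightarrow> bool" where
  "hyperbolic_group G S \<longleftrightarrow> group G \<and> finite S \<and> S \<subseteq> carrier G \<and> generate G S = carrier G
     \<and> gromov_hyperbolic_on (cayley_points G S) (cayley_dist G S)"

text \<open>Non-elementary: G contains a free subgroup of rank 2, i.e. there are a, b such that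
  no nonempty freely reduced word in a, b evaluates to the identity.\<close>
definition freely_reduced :: "('a \<times> bool) list \<Rightarrow> bool" where
  "freely_reduced w \<longleftrightarrow> (\<forall>i. Suc i < length w \<longrightarrow>
      \<not> (fst (w ! i) = fst (w ! Suc i) \<and> snd (w ! i) \<noteq> snd (w ! Suc i)))"

definition non_elementary :: "('g, 'b) monoid_scheme \<Rightarrow> bool" where
  "non_elementary G \<longleftrightarrow> (\<exists>a\<in>carrier G. \<exists>b\<in>carrier G.
     \<forall>w :: (bool \<times> bool) list. w \<noteq> [] \<and> freely_reduced w \<longrightarrow>
        eval_word G (map (\<lambda>(i, e). (if i then a else b, e)) w) \<noteq> \<one>\<^bsub>G\<^esub>)"

definition characteristic_subgroup :: "'g set \<Rightarrow> ('g, 'b) monoid_scheme \<Rightarrow> bool" where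
  "characteristic_subgroup A G \<longleftrightarrow> subgroup A G \<and> (\<forall>\<phi>\<in>iso G G. \<phi> ` A = A)"

definition infinite_order :: "('g, 'b) monoid_scheme \<Rightarrow> 'g \<Rightarrow> bool" where
  "infinite_order G a \<longleftrightarrow> (\<forall>n::nat. n > 0 \<longrightarrow> a [^]\<^bsub>G\<^esub> n \<noteq> \<one>\<^bsub>G\<^esub>)"

definition cayley_geodesic :: "('g, 'b) monoid_scheme \<Rightarrow> 'g set \<Rightarrow> (real \<Rightarrow> 'g \<times> 'g \<times> real) \<Rightarrow> bool" where
  "cayley_geodesic G S c \<longleftrightarrow> (\<forall>t. c t \<in> cayley_points G S) \<and>
     (\<forall>s t. cayley_dist G S (c s) (c t) = \<bar>s - t\<bar>)"

text \<open>c(t) converges (as t \<rightarrow> +\<infinity>) to the same point of the Gromov boundary as the sequence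
  of vertices g^n: the Gromov products (based at the identity vertex) tend to infinity.\<close>
definition conv_to_pow :: "('g, 'b) monoid_scheme \<Rightarrow> 'g set \<Rightarrow> (real \<Rightarrow> 'g \<times> 'g \<times> real) \<Rightarrow> 'g \<Rightarrow> bool" where
  "conv_to_pow G S c g \<longleftrightarrow> (\<forall>M. \<exists>T N. \<forall>t\<ge>T. \<forall>n\<ge>N.
      gromov_prod (cayley_dist G S) (cayley_vertex G \<one>\<^bsub>G\<^esub>) (c t) (cayley_vertex G (g [^]\<^bsub>G\<^esub> (n::nat))) \<ge> M)"

text \<open>L_S(a): geodesics of C_S(G) joining a^- (limit of a^{-n}) and a^+ (limit of a^n).\<close>
definition L_S :: "('g, 'b) monoid_scheme \<Rightarrow> 'g set \<Rightarrow> 'g \<Rightarrow> (real \<Rightarrow> 'g \<times> 'g \<times> real) set" where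
  "L_S G S a = {c. cayley_geodesic G S c \<and> conv_to_pow G S c a
                  \<and> conv_to_pow G S (\<lambda>t. c (- t)) (inv\<^bsub>G\<^esub> a)}"

definition proper_space :: "'x::metric_space itself \<Rightarrow> bool" where
  "proper_space _ \<longleftrightarrow> (\<forall>x::'x. \<forall>r. compact (cball x r))"

definition geodesic_space :: "'x::metric_space itself \<Rightarrow> bool" where
  "geodesic_space _ \<longleftrightarrow> (\<forall>x y :: 'x. \<exists>c. c 0 = x \<and> c (dist x y) = y \<and>
      (\<forall>s\<in>{0..dist x y}. \<forall>t\<in>{0..dist x y}. dist (c s) (c t) = \<bar>s - t\<bar>))"

definition isometry :: "('x::metric_space \<Rightarrow> 'x) \<Rightarrow> bool" where
  "isometry f \<longleftrightarrow> bij f \<and> (\<forall>x y. dist (f x) (f y) = dist x y)"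

definition isom_rep :: "('g, 'b) monoid_scheme \<Rightarrow> ('g \<Rightarrow> 'x::metric_space \<Rightarrow> 'x) \<Rightarrow> bool" where
  "isom_rep G \<rho> \<longleftrightarrow> (\<forall>g\<in>carrier G. isometry (\<rho> g)) \<and>
     (\<forall>g\<in>carrier G. \<forall>h\<in>carrier G. \<rho> (g \<otimes>\<^bsub>G\<^esub> h) = \<rho> g \<circ> \<rho> h)"

definition trans_length :: "('x::metric_space \<Rightarrow> 'x) \<Rightarrow> real" where
  "trans_length f = Inf (range (\<lambda>x. dist x (f x)))"

definition orbit_edge_data :: "'g set \<Rightarrow> ('g \<Rightarrow> 'x::metric_space \<Rightarrow> 'x) \<Rightarrow> 'x \<Rightarrow> ('g \<Rightarrow> real \<Rightarrow> 'x) \<Rightarrow> bool" where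
  "orbit_edge_data S \<rho> x \<sigma> \<longleftrightarrow> (\<forall>s\<in>S. \<sigma> s 0 = x \<and> \<sigma> s 1 = \<rho> s x \<and>
     (\<forall>u\<in>{0..1}. \<forall>v\<in>{0..1}. dist (\<sigma> s u) (\<sigma> s v) = \<bar>u - v\<bar> * dist x (\<rho> s x)))"

definition orbit_map :: "('g \<Rightarrow> 'x \<Rightarrow> 'x) \<Rightarrow> 'x \<Rightarrow> ('g \<Rightarrow> real \<Rightarrow> 'x) \<Rightarrow> 'g \<times> 'g \<times> real \<Rightarrow> 'x" where
  "orbit_map \<rho> x \<sigma> p = (case p of (g, s, t) \<Rightarrow> if t = 0 then \<rho> g x else \<rho> g (\<sigma> s t))"

definition quasi_geodesic :: "real \<Rightarrow> real \<Rightarrow> (real \<Rightarrow> 'x::metric_space) \<Rightarrow> bool" where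
  "quasi_geodesic K C f \<longleftrightarrow> (\<forall>s t. \<bar>s - t\<bar> / K - C \<le> dist (f s) (f t) \<and> dist (f s) (f t) \<le> K * \<bar>s - t\<bar> + C)"

definition A_stable :: "('g, 'b) monoid_scheme \<Rightarrow> 'g set \<Rightarrow> 'g set \<Rightarrow> ('g \<Rightarrow> 'x::metric_space \<Rightarrow> 'x) \<Rightarrow> bool" where
  "A_stable G S A \<rho> \<longleftrightarrow> (\<exists>K\<ge>1. \<exists>C\<ge>0. \<exists>x \<sigma>. orbit_edge_data S \<rho> x \<sigma> \<and>
     (\<forall>a\<in>A. infinite_order G a \<longrightarrow>
        (\<forall>c\<in>L_S G S a. quasi_geodesic K C (orbit_map \<rho> x \<sigma> \<circ> c))))"

definition A_well_displacing :: "('g, 'b) monoid_scheme \<Rightarrow> 'g set \<Rightarrow> 'g set \<Rightarrow> ('g \<Rightarrow> 'x::metric_space \<Rightarrow> 'x) \<Rightarrow> bool" where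
  "A_well_displacing G S A \<rho> \<longleftrightarrow> (\<exists>J\<ge>1. \<exists>B\<ge>0. \<forall>a\<in>A.
     trans_length_S G S a / J - B \<le> trans_length (\<rho> a) \<and> trans_length (\<rho> a) \<le> J * trans_length_S G S a + B)"

end

theory Submission
  imports Defs "HOL-Library.Diagonal_Subsequence"
begin

text \<open>Everything is measured on vertices, where the Cayley metric is the word metric up to 2.
  Write \<open>|g|\<close> for the word length.

  Stable implies well-displacing: if \<open>|a\<^sup>2|\<close> does not exceed \<open>|a|\<close> by much, then the midpoint of a geodesic
  from \<open>\<one>\<close> to \<open>a\<close> is moved little by \<open>a\<close>. Otherwise the powers of \<open>a\<close> form a quasi-geodesic by the
  local-to-global principle, they stay close to a geodesic in \<open>L_S(a)\<close>, and the quasi-geodesic bound on its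
  image limits the growth of \<open>|a\<^sup>n|\<close>, hence \<open>|a\<^sup>2| - |a|\<close>, in terms of the displacement of \<open>\<rho>(a)\<close>.
  The upper bound is the Lipschitz property of orbit maps.

  Well-displacing implies stable: if some \<open>L_S(a)\<close> with \<open>a \<in> A\<close> is nonempty, then \<open>A\<close> contains a loxodromic \<open>b\<close>,
  and since the group is not elementary some conjugate of \<open>b\<close> is independent of \<open>b\<close>. As \<open>A\<close> is normal, for every
  \<open>h\<close> a product \<open>h f h\<^sup>-\<^sup>1 f'\<close> lies in \<open>A\<close>, where \<open>f\<close> and \<open>f'\<close> are suitable powers of these two elements chosen from
  a finite set, and it has translation length at least \<open>2|h| - C\<close>. Its image displaces the base point \<open>x\<close> by at
  most \<open>2 d(x, \<rho>(h) x) + C'\<close>, so the orbit map is a quasi-isometric embedding of the whole group.\<close>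

section \<open>Gromov products\<close>

text \<open>The obstacle is uniformity: J and B must serve all a at once, while the constants of the
  quasi-geodesic of powers depend on a. They enter the estimates of \<open>|a\<^sup>n|\<close>
  additively and vanish on dividing by n; only the rate survives, and \<open>lox_growth\<close>
  gives a rate that is explicit in |a|, \<open>|a\<^sup>2|\<close> and \<delta>. Near-additivity,
  \<open>|a^m| + |a^n| <= |a^(m+n)| + 2k\<close>, plays the part of the stability of
  quasi-geodesics: it bounds Gromov products, and these place the powers near geodesics. Ends are
  likewise compared by Gromov products of powers. The case splits deal with elements not known to be
  loxodromic. In one direction such an element has a short square, in the other the absence of
  geodesics in L_S(A) leaves nothing to prove. In the second direction h itself need not lie in A,
  so it is brought in through a conjugate. The elements f and f' separate h from its inverse and
  stop cancellation, and as h occurs twice in both estimates the factor J is kept.\<close>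

locale hyp_metric =
  fixes P :: "'p set" and d :: "'p \<Rightarrow> 'p \<Rightarrow> real" and \<delta> :: real
  assumes d_self: "x \<in> P \<Longrightarrow> d x x = 0"
    and d_sym: "x \<in> P \<Longrightarrow> y \<in> P \<Longrightarrow> d x y = d y x"
    and d_tri: "x \<in> P \<Longrightarrow> y \<in> P \<Longrightarrow> z \<in> P \<Longrightarrow> d x z \<le> d x y + d y z"
    and delta_nonneg: "0 \<le> \<delta>"
    and hyp: "w \<in> P \<Longrightarrow> x \<in> P \<Longrightarrow> y \<in> P \<Longrightarrow> z \<in> P \<Longrightarrow>
      gromov_prod d w x z \<ge> min (gromov_prod d w x y) (gromov_prod d w y z) - \<delta>"
begin

abbreviation gp :: "'p \<Rightarrow> 'p \<Rightarrow> 'p \<Rightarrow> real" where "gp \<equiv> gromov_prod d"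

lemma gp_nonneg: "w \<in> P \<Longrightarrow> x \<in> P \<Longrightarrow> y \<in> P \<Longrightarrow> 0 \<le> gp w x y"
  using d_tri[of x w y] d_sym[of w y] by (simp add: gromov_prod_def)

lemma gp_sym: "x \<in> P \<Longrightarrow> y \<in> P \<Longrightarrow> gp w x y = gp w y x"
  using d_sym[of x y] by (simp add: gromov_prod_def)

lemma gp_swap_base: "w \<in> P \<Longrightarrow> x \<in> P \<Longrightarrow> y \<in> P \<Longrightarrow> gp x w y = d w x - gp w x y"
  using d_sym[of w x] d_sym[of y w] d_sym[of y x] by (simp add: gromov_prod_def field_simps)

lemma hyp_ge:
  assumes "w \<in> P" "x \<in> P" "y \<in> P" "z \<in> P" "t \<le> gp w x y" "t \<le> gp w y z"
  shows "t - \<delta> \<le> gp w x z"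
  using hyp[of w x y z] assms by (simp add: min_def split: if_splits)

lemma hyp_ge2:
  assumes "w \<in> P" "x \<in> P" "y \<in> P" "z \<in> P" "u \<in> P"
    and "t \<le> gp w x y" "t \<le> gp w y z" "t \<le> gp w z u"
  shows "t - 2 * \<delta> \<le> gp w x u"
  using hyp_ge[of w x y z t] hyp_ge[of w x z u "t - \<delta>"] assms delta_nonneg by simp

text \<open>Local-to-global principle: a path of long steps with small Gromov products at its corners
  never turns back.\<close>

lemma local_to_global:
  fixes p :: "nat \<Rightarrow> 'p"
  assumes P: "\<And>i. p i \<in> P"
    and turn: "\<And>i. gp (p (Suc i)) (p i) (p (Suc (Suc i))) \<le> \<kappa>"
    and long: "\<And>i. d (p i) (p (Suc i)) > 2 * \<kappa> + 2 * \<delta>"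
  shows "gp (p n) (p 0) (p (Suc n)) \<le> \<kappa> + \<delta>"
proof (induction n)
  case 0
  have "0 \<le> \<kappa>" using gp_nonneg[of "p 1" "p 0" "p 2"] turn[of 0] P by (simp add: numeral_2_eq_2)
  then show ?case using delta_nonneg d_self[OF P] d_sym[OF P P, of 0 1] by (simp add: gromov_prod_def)
next
  case (Suc n)
  \<comment> \<open>The products at the two ends of a step add up to its length, so the small one at
    \<open>p n\<close> forces a large one here.\<close>
  have "gp (p (Suc n)) (p 0) (p n) > \<kappa> + \<delta>"
    using Suc long[of n] gp_swap_base[of "p n" "p (Suc n)" "p 0"] P by (simp add: gp_sym)
  \<comment> \<open>Four-point condition with \<open>p 0\<close> in the middle: the corner product
    is at most \<kappa>, so one of the two products with \<open>p 0\<close> is at most \<kappa> +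
    \<delta>, and by the previous step it is the one with the next point.\<close>
  then show ?case
    using hyp[of "p (Suc n)" "p n" "p 0" "p (Suc (Suc n))"] turn[of n] P gp_sym[OF P P, of _ 0 n]
    by (simp add: min_def split: if_splits)
qed

lemma local_to_global_dist:
  fixes p :: "nat \<Rightarrow> 'p"
  assumes "\<And>i. p i \<in> P"
    and "\<And>i. gp (p (Suc i)) (p i) (p (Suc (Suc i))) \<le> \<kappa>"
    and "\<And>i. d (p i) (p (Suc i)) > 2 * \<kappa> + 2 * \<delta>"
  shows "d (p 0) (p (Suc n)) \<ge> d (p 0) (p n) + d (p n) (p (Suc n)) - 2 * \<kappa> - 2 * \<delta>"
  using local_to_global[of p, OF assms, of n] d_sym[of "p n" "p (Suc n)"] assms(1)
  by (simp add: gromov_prod_def)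

text \<open>\<open>gp x y w \<ge> d x y - k\<close> says that y lies on the way from x to w up to k.
  Two such points share their way up to the nearer of them, so nearly equal distances from x make
  them close.\<close>

lemma close_of_gp:
  assumes "x \<in> P" "y \<in> P" "z \<in> P" "w \<in> P"
    and "gp x y w \<ge> d x y - k" "gp x z w \<ge> d x z - k" "\<bar>d x y - d x z\<bar> \<le> r"
  shows "d y z \<le> r + 2 * k + 2 * \<delta>"
proof -
  have "gp x y z \<ge> min (d x y) (d x z) - k - \<delta>"
    using assms gp_sym[of z w] by (intro hyp_ge[of x y w z]) auto
  then show ?thesis
    using assms(7) d_sym[of x y] d_sym[of x z] assms(1-4) by (simp add: gromov_prod_def min_def split: if_splits)
qed

text \<open>The same condition read at the other end: by \<open>gp_swap_base\<close>, a small
  product at y of x and w means that y lies nearly between them.\<close>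

lemma close_of_between:
  assumes "x \<in> P" "y \<in> P" "z \<in> P" "w \<in> P"
    and "gp y x w \<le> k" "gp z x w \<le> k" "\<bar>d x y - d x z\<bar> \<le> r"
  shows "d y z \<le> r + 2 * k + 2 * \<delta>"
  using close_of_gp[of x y z w k r] assms gp_swap_base[of x y w] gp_swap_base[of x z w]
  by linarith

end

section \<open>The word metric\<close>

lemma (in group) inv_mult_cancel [simp]:
  "x \<in> carrier G \<Longrightarrow> y \<in> carrier G \<Longrightarrow> inv x \<otimes> (x \<otimes> y) = y"
  "x \<in> carrier G \<Longrightarrow> y \<in> carrier G \<Longrightarrow> x \<otimes> (inv x \<otimes> y) = y"
  by (simp_all add: m_assoc[symmetric])

locale word_metric = group G for G (structure) +
  fixes S :: "'a set"
  assumes fin_S: "finite S" and S_carrier: "S \<subseteq> carrier G" and gen: "generate G S = carrier G"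
begin

abbreviation d :: "'a \<Rightarrow> 'a \<Rightarrow> real" where "d \<equiv> word_dist G S"
abbreviation N :: "'a \<Rightarrow> nat" where "N \<equiv> word_length G S"

abbreviation is_word :: "('a \<times> bool) list \<Rightarrow> bool" where "is_word w \<equiv> set (map fst w) \<subseteq> S"

lemma eval_word_Nil: "eval_word G [] = \<one>"
  by (simp add: eval_word_def)

lemma eval_word_Cons: "eval_word G ((s, b) # w) = (if b then s else inv s) \<otimes> eval_word G w"
  by (simp add: eval_word_def)

lemma eval_word_carrier:
  "fst ` set w \<subseteq> carrier G \<Longrightarrow> eval_word G w \<in> carrier G"
  by (induction w) (auto simp: eval_word_Nil eval_word_Cons)

lemma is_word_carrier: "is_word w \<Longrightarrow> eval_word G w \<in> carrier G"
  using S_carrier eval_word_carrier[of w] by auto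

lemma eval_word_append:
  "fst ` set v \<subseteq> carrier G \<Longrightarrow> fst ` set w \<subseteq> carrier G \<Longrightarrow>
    eval_word G (v @ w) = eval_word G v \<otimes> eval_word G w"
proof (induction v)
  case (Cons a v)
  then show ?case
    using eval_word_carrier[of v] eval_word_carrier[of w]
    by (cases a) (auto simp: eval_word_Nil eval_word_Cons m_assoc)
qed (use eval_word_carrier in \<open>auto simp: eval_word_Nil\<close>)

lemma is_word_append: "is_word v \<Longrightarrow> is_word w \<Longrightarrow> eval_word G (v @ w) = eval_word G v \<otimes> eval_word G w"
  using S_carrier eval_word_append[of v w] by auto

lemma inverse_word:
  "is_word w \<Longrightarrow> \<exists>v. length v = length w \<and> is_word v \<and> eval_word G v = inv (eval_word G w)"
proof (induction w)
  case (Cons a w)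
  obtain s b where a: "a = (s, b)" by (cases a)
  then obtain v where v: "length v = length w" "is_word v" "eval_word G v = inv (eval_word G w)"
    using Cons by auto
  have s: "s \<in> S" "s \<in> carrier G" using Cons a S_carrier by auto
  have "eval_word G w \<in> carrier G" using Cons is_word_carrier by simp
  then have "eval_word G (v @ [(s, \<not> b)]) = inv (eval_word G (a # w))"
    using v s a is_word_append[of v "[(s, \<not> b)]"]
    by (cases b) (simp_all add: eval_word_Nil eval_word_Cons inv_mult_group)
  then show ?case using v s by (intro exI[of _ "v @ [(s, \<not> b)]"]) simp
qed (simp add: eval_word_Nil)

lemma word_exists: "g \<in> carrier G \<Longrightarrow> \<exists>w. is_word w \<and> eval_word G w = g"
  unfolding gen[symmetric]
proof (induction rule: generate.induct)
  case one
  then show ?case by (intro exI[of _ "[]"]) (simp add: eval_word_Nil)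
next
  case (incl h)
  then show ?case using S_carrier by (intro exI[of _ "[(h, True)]"]) (auto simp: eval_word_Nil eval_word_Cons)
next
  case (inv h)
  then show ?case using S_carrier by (intro exI[of _ "[(h, False)]"]) (auto simp: eval_word_Nil eval_word_Cons)
next
  case (eng h1 h2)
  then obtain v w where "is_word v" "eval_word G v = h1" "is_word w" "eval_word G w = h2" by auto
  then show ?case using is_word_append[of v w] by (intro exI[of _ "v @ w"]) simp
qed

lemma N_word:
  assumes "g \<in> carrier G"
  obtains w where "length w = N g" "is_word w" "eval_word G w = g"
proof -
  have "\<exists>n w. length w = n \<and> is_word w \<and> eval_word G w = g"
    using word_exists[OF assms] by blast
  then have "\<exists>w. length w = N g \<and> is_word w \<and> eval_word G w = g"
    unfolding word_length_def by (rule LeastI_ex)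
  then show ?thesis using that by blast
qed

lemma N_le: "is_word w \<Longrightarrow> N (eval_word G w) \<le> length w"
  unfolding word_length_def by (rule Least_le) blast

lemma N_one [simp]: "N \<one> = 0"
  using N_le[of "[]"] by (simp add: eval_word_Nil)

lemma N_mult: "g \<in> carrier G \<Longrightarrow> h \<in> carrier G \<Longrightarrow> N (g \<otimes> h) \<le> N g + N h"
proof -
  assume g: "g \<in> carrier G" "h \<in> carrier G"
  obtain v where v: "length v = N g" "is_word v" "eval_word G v = g" using N_word[OF g(1)] .
  obtain w where w: "length w = N h" "is_word w" "eval_word G w = h" using N_word[OF g(2)] .
  show "N (g \<otimes> h) \<le> N g + N h"
    using N_le[of "v @ w"] is_word_append[OF v(2) w(2)] v w by simp
qed

lemma N_inv_le: "g \<in> carrier G \<Longrightarrow> N (inv g) \<le> N g"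
  using N_le inverse_word by (metis N_word)

lemma N_inv [simp]: "g \<in> carrier G \<Longrightarrow> N (inv g) = N g"
  using N_inv_le[of g] N_inv_le[of "inv g"] by simp

lemma N_one_cases:
  assumes "g \<in> carrier G" "N g = 1" shows "g \<in> S \<or> inv g \<in> S"
proof -
  obtain w where w: "length w = N g" "is_word w" "eval_word G w = g" using N_word assms(1) .
  then obtain s b where "w = [(s, b)]" using assms(2) by (auto simp: length_Suc_conv)
  then show ?thesis using w S_carrier by (cases b) (auto simp: eval_word_Nil eval_word_Cons)
qed

lemma N_gen: "s \<in> S \<Longrightarrow> N s \<le> 1"
  using N_le[of "[(s, True)]"] S_carrier by (auto simp: eval_word_Nil eval_word_Cons)

text \<open>The source of all compactness below: the unboundedness of powers, the pigeonhole
  arguments and the limit of geodesic segments rest on it.\<close>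

lemma finite_ball: "finite {g \<in> carrier G. real (N g) \<le> r}"
proof -
  have "{g \<in> carrier G. real (N g) \<le> r} \<subseteq> eval_word G ` {w. set w \<subseteq> S \<times> UNIV \<and> length w \<le> nat \<lfloor>r\<rfloor>}"
  proof
    fix g assume g: "g \<in> {g \<in> carrier G. real (N g) \<le> r}"
    then obtain w where "length w = N g" "is_word w" "eval_word G w = g" using N_word by blast
    moreover have "N g \<le> nat \<lfloor>r\<rfloor>" using g by (simp add: le_nat_floor)
    ultimately show "g \<in> eval_word G ` {w. set w \<subseteq> S \<times> UNIV \<and> length w \<le> nat \<lfloor>r\<rfloor>}"
      by force
  qed
  then show ?thesis
    by (rule finite_subset) (intro finite_imageI finite_lists_length_le finite_cartesian_product fin_S finite)
qed

lemma d_one [simp]: "g \<in> carrier G \<Longrightarrow> d \<one> g = N g"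
  by (simp add: word_dist_def)

lemma d_one_right [simp]: "g \<in> carrier G \<Longrightarrow> d g \<one> = N g"
  by (simp add: word_dist_def)

lemma d_nonneg: "0 \<le> d g h"
  by (simp add: word_dist_def)

lemma d_same [simp]: "g \<in> carrier G \<Longrightarrow> d g g = 0"
  by (simp add: word_dist_def)

lemma d_commute: "g \<in> carrier G \<Longrightarrow> h \<in> carrier G \<Longrightarrow> d g h = d h g"
  using N_inv[of "inv g \<otimes> h"] by (simp add: word_dist_def inv_mult_group)

lemma d_triangle:
  "g \<in> carrier G \<Longrightarrow> h \<in> carrier G \<Longrightarrow> k \<in> carrier G \<Longrightarrow> d g k \<le> d g h + d h k"
  using N_mult[of "inv g \<otimes> h" "inv h \<otimes> k"] by (simp add: word_dist_def m_assoc)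

lemma d_left_mult [simp]:
  "g \<in> carrier G \<Longrightarrow> h \<in> carrier G \<Longrightarrow> k \<in> carrier G \<Longrightarrow> d (k \<otimes> g) (k \<otimes> h) = d g h"
  by (simp add: word_dist_def inv_mult_group m_assoc)

lemma d_right_mult: "g \<in> carrier G \<Longrightarrow> h \<in> carrier G \<Longrightarrow> d g (g \<otimes> h) = N h"
  by (simp add: word_dist_def)

text \<open>The points are g times the prefixes of a shortest word for
  \<open>inv g \<otimes> h\<close>.\<close>

lemma discrete_geodesic:
  assumes g: "g \<in> carrier G" "h \<in> carrier G"
  obtains f :: "nat \<Rightarrow> 'a" and L :: nat where "\<And>i. f i \<in> carrier G" "f 0 = g" "f L = h" "d g h = L"
    "\<And>i j. i \<le> j \<Longrightarrow> j \<le> L \<Longrightarrow> d (f i) (f j) = real j - real i"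
proof -
  define L where "L = N (inv g \<otimes> h)"
  obtain w where w: "length w = L" "is_word w" "eval_word G w = inv g \<otimes> h"
    using N_word[of "inv g \<otimes> h"] g L_def by auto
  define f where "f i = g \<otimes> eval_word G (take i w)" for i
  have tw: "is_word (take i w)" for i using w(2) set_take_subset[of i w] by auto
  have fc: "f i \<in> carrier G" for i
    unfolding f_def using g is_word_carrier[OF tw] by auto
  have f0: "f 0 = g" using g by (simp add: f_def eval_word_Nil)
  have fl: "f L = h" using w g by (simp add: f_def)
  have up: "d (f i) (f j) \<le> real j - real i" if "i \<le> j" "j \<le> L" for i j
  proof -
    have tj: "take j w = take i w @ take (j - i) (drop i w)"
      using that by (metis le_add_diff_inverse take_add)
    have v: "is_word (take (j - i) (drop i w))"
      using w(2) set_take_subset[of "j-i" "drop i w"] set_drop_subset[of i w] by auto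
    then have "f j = f i \<otimes> eval_word G (take (j - i) (drop i w))"
      unfolding f_def tj using is_word_append[OF tw v] is_word_carrier[OF v] is_word_carrier[OF tw[of i]] g
      by (simp add: m_assoc)
    then show ?thesis
      using d_right_mult[OF fc is_word_carrier[OF v], of i] N_le[OF v] that w(1) by simp
  qed
  have dl: "d g h = L" by (simp add: word_dist_def L_def)
  \<comment> \<open>The upper bounds on the three pieces add up to \<open>d g h\<close>, so each of
    them is attained.\<close>
  have "d (f i) (f j) = real j - real i" if "i \<le> j" "j \<le> L" for i j
    using up[of 0 i] up[of i j] up[of j L] that dl d_triangle[OF fc fc fc, of 0 L i]
      d_triangle[OF fc fc fc, of i L j]
    unfolding f0 fl by linarith
  then show ?thesis using that fc f0 fl dl by blast
qed

lemma pow_inj: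
  assumes "a \<in> carrier G" "infinite_order G a" "a [^] (i::int) = a [^] (j::int)"
  shows "i = j"
proof -
  have *: "i = j" if "i \<le> j" "a [^] (i::int) = a [^] (j::int)" for i j
  proof (rule ccontr)
    assume "i \<noteq> j"
    define k where "k = nat (j - i)"
    have k: "j = i + int k" "0 < k" using \<open>i \<le> j\<close> \<open>i \<noteq> j\<close> by (simp_all add: k_def)
    have "a [^] j = a [^] i \<otimes> a [^] k"
      using assms(1) by (simp add: k(1) int_pow_mult int_pow_int)
    then have "a [^] i \<otimes> a [^] k = a [^] i \<otimes> \<one>"
      using that(2) assms(1) by (metis int_pow_closed r_one)
    then have "a [^] k = \<one>" using assms(1) by (subst (asm) Units_l_cancel) auto
    then show False using assms(2) k(2) unfolding infinite_order_def by blast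
  qed
  show ?thesis
  proof (cases "i \<le> j")
    case True
    then show ?thesis using * assms(3) by blast
  next
    case False
    then show ?thesis using *[of j i] assms(3)[symmetric] by (simp only: linear not_le less_imp_le)
  qed
qed

lemma N_pow_unbounded:
  assumes "a \<in> carrier G" "infinite_order G a"
  shows "\<exists>n\<ge>m. real (N (a [^] (n::nat))) > r"
proof (rule ccontr)
  assume "\<not> ?thesis"
  then have "(\<lambda>n. a [^] (n::nat)) ` {m..} \<subseteq> {g \<in> carrier G. real (N g) \<le> r}"
    using assms by (force simp: not_less)
  then have "finite ((\<lambda>n. a [^] (n::nat)) ` {m..})" using finite_ball finite_subset by blast
  moreover have "inj (\<lambda>n::nat. a [^] n)"
  proof (rule injI)
    fix m n :: nat
    assume "a [^] m = a [^] n"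
    then have "int m = int n" using pow_inj[OF assms, of "int m" "int n"] by (simp add: int_pow_int)
    then show "m = n" by simp
  qed
  ultimately have "finite {m..}" by (metis finite_imageD inj_on_subset subset_UNIV)
  then show False using infinite_Ici by blast
qed

end

locale hyp_group = word_metric G S for G (structure) and S +
  fixes \<delta> :: real
  assumes \<delta>: "0 \<le> \<delta>" and four_point: "w \<in> carrier G \<Longrightarrow> x \<in> carrier G \<Longrightarrow> y \<in> carrier G \<Longrightarrow> z \<in> carrier G \<Longrightarrow>
      gromov_prod d w x z \<ge> min (gromov_prod d w x y) (gromov_prod d w y z) - \<delta>"

sublocale hyp_group \<subseteq> hyp_metric "carrier G" "word_dist G S" \<delta>
  by unfold_locales (use d_commute d_triangle \<delta> four_point in auto)

section \<open>Loxodromic elements\<close>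

text \<open>Divide by n and let n grow: bounds on n-th powers become bounds on rates, whatever the
  additive error.\<close>

lemma archimedean_le:
  fixes e e' c :: real
  assumes "\<And>n::nat. real n * e \<le> real n * e' + c"
  shows "e \<le> e'"
proof (rule ccontr)
  assume "\<not> e \<le> e'"
  then obtain n :: nat where "c < real n * (e - e')" using reals_Archimedean3[of "e - e'"] by auto
  then show False using assms[of n] by (simp add: algebra_simps)
qed

lemma (in word_metric) d_pow:
  assumes "a \<in> carrier G" "m \<le> n"
  shows "d (a [^] m) (a [^] (n::nat)) = N (a [^] (n - m))"
  using d_right_mult[of "a [^] m" "a [^] (n - m)"] nat_pow_mult[of a m "n - m"] assms by simp

lemma (in word_metric) N_pow_inv: "a \<in> carrier G \<Longrightarrow> N (inv a [^] (n::nat)) = N (a [^] n)"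
  by (simp add: nat_pow_inv)

lemma (in word_metric) N_pow_le: "a \<in> carrier G \<Longrightarrow> N (a [^] (n::nat)) \<le> n * N a"
proof (induction n)
  case (Suc n)
  then show ?case using N_mult[of "a [^] n" a] by simp
qed simp

text \<open>Iterate the displacement at g, then move the base point to \<open>\<one>\<close>. Read
  backwards, this turns a growth rate of powers into a lower bound for the displacement of every
  vertex.\<close>

lemma (in word_metric) N_pow_le_displacement:
  assumes "a \<in> carrier G" "g \<in> carrier G"
  shows "real (N (a [^] (n::nat))) \<le> real n * d g (a \<otimes> g) + 2 * real (N g)"
proof -
  have "d g (a [^] n \<otimes> g) \<le> real n * d g (a \<otimes> g)"
  proof (induction n)
    case (Suc n)
    have "d g (a [^] Suc n \<otimes> g) \<le> d g (a [^] n \<otimes> g) + d (a [^] n \<otimes> g) (a [^] n \<otimes> (a \<otimes> g))"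
      using d_triangle[of g "a [^] n \<otimes> g" "a [^] n \<otimes> (a \<otimes> g)"] assms by (simp add: m_assoc)
    then show ?case using Suc d_left_mult[of g "a \<otimes> g" "a [^] n"] assms by (simp add: algebra_simps)
  qed (use assms in simp)
  moreover have "d \<one> (a [^] n) \<le> d \<one> g + d g (a [^] n \<otimes> g) + d (a [^] n \<otimes> g) (a [^] n)"
    using d_triangle[of \<one> g "a [^] n"] d_triangle[of g "a [^] n \<otimes> g" "a [^] n"] assms by simp
  moreover have "d (a [^] n \<otimes> g) (a [^] n) = N g"
    using d_left_mult[of g \<one> "a [^] n"] assms by simp
  ultimately show ?thesis using assms by simp
qed

context hyp_group
begin

text \<open>Loxodromy read off from two word lengths. The path of powers has steps of length |a| and
  corner products \<open>\<kappa> = |a| - |a\<^sup>2| / 2\<close>, so \<open>local_to_global\<close>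
  asks for \<open>|a\<^sup>2| > |a| + 2\<delta>\<close>; the third \<delta> is spent in
  \<open>lox_additive\<close>.\<close>

definition lox :: "'a \<Rightarrow> bool" where
  "lox a \<longleftrightarrow> a \<in> carrier G \<and> real (N (a [^] (2::nat))) > real (N a) + 3 * \<delta>"

lemma lox_carrier: "lox a \<Longrightarrow> a \<in> carrier G"
  by (simp add: lox_def)

lemma gp_pow_step:
  assumes "a \<in> carrier G"
  shows "gp (a [^] Suc i) (a [^] i) (a [^] Suc (Suc i)) = real (N a) - real (N (a [^] (2::nat))) / 2"
proof -
  have "Suc (Suc i) - i = 2" by simp
  then have "d (a [^] i) (a [^] Suc (Suc i)) = N (a [^] (2::nat))"
    using d_pow[OF assms, of i "Suc (Suc i)"] by (simp del: nat_pow_Suc)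
  moreover have "d (a [^] i) (a [^] Suc i) = N a" "d (a [^] Suc i) (a [^] Suc (Suc i)) = N a"
    using d_pow[OF assms, of i "Suc i"] d_pow[OF assms, of "Suc i" "Suc (Suc i)"] assms by simp_all
  moreover have "d (a [^] Suc (Suc i)) (a [^] Suc i) = d (a [^] Suc i) (a [^] Suc (Suc i))"
    using assms by (intro d_commute) simp_all
  ultimately show ?thesis by (simp add: gromov_prod_def del: nat_pow_Suc)
qed

lemma lox_chain:
  assumes "lox a"
  defines "\<kappa> \<equiv> real (N a) - real (N (a [^] (2::nat))) / 2"
  shows "gp (a [^] n) \<one> (a [^] Suc n) \<le> \<kappa> + \<delta>"
    and "real (N (a [^] Suc n)) \<ge> real (N (a [^] n)) + real (N a) - 2 * \<kappa> - 2 * \<delta>"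
proof -
  have a: "a \<in> carrier G" using assms lox_carrier by simp
  define p where "p = (\<lambda>n::nat. a [^] n)"
  have dp: "d (p i) (p (Suc i)) = N a" for i
    using d_pow[OF a, of i "Suc i"] a by (simp add: p_def)
  have p: "p i \<in> carrier G" "gp (p (Suc i)) (p i) (p (Suc (Suc i))) \<le> \<kappa>"
    "d (p i) (p (Suc i)) > 2 * \<kappa> + 2 * \<delta>" for i
    using gp_pow_step[OF a, of i] a assms(1) delta_nonneg unfolding dp unfolding p_def \<kappa>_def lox_def
    by (simp_all del: nat_pow_Suc)
  show "gp (a [^] n) \<one> (a [^] Suc n) \<le> \<kappa> + \<delta>"
    using local_to_global[of p, OF p] by (simp add: p_def)
  show "real (N (a [^] Suc n)) \<ge> real (N (a [^] n)) + real (N a) - 2 * \<kappa> - 2 * \<delta>"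
    using local_to_global_dist[of p, OF p, of n] a unfolding dp by (simp add: p_def)
qed

lemma lox_growth:
  assumes "lox a"
  shows "real (N (a [^] (n::nat))) \<ge> real n * (real (N (a [^] (2::nat))) - real (N a) - 2 * \<delta>)"
proof (induction n)
  case (Suc n)
  then show ?case using lox_chain(2)[OF assms, of n] by (simp add: algebra_simps del: nat_pow_Suc)
qed simp

text \<open>The chain controls the corner at \<open>a\<^sup>m\<close> only towards the next power.
  Seen from \<open>a\<^sup>m\<close>, that power and a^(m+n) lie in the same direction, so the
  control extends to all later powers. The constant k depends on a, but not on m and n.\<close>

lemma lox_additive:
  assumes "lox a"
  obtains k where "0 \<le> k"
    "\<And>m n::nat. real (N (a [^] m)) + real (N (a [^] n)) \<le> real (N (a [^] (m + n))) + 2 * k"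
proof -
  define \<kappa> where "\<kappa> = real (N a) - real (N (a [^] (2::nat))) / 2"
  have a: "a \<in> carrier G" using assms lox_carrier by simp
  have k0: "0 \<le> \<kappa>"
    using gp_pow_step[OF a, of 0] gp_nonneg[of "a [^] Suc 0" "a [^] (0::nat)" "a [^] Suc (Suc 0)"] a
    by (simp add: \<kappa>_def)
  have "real (N (a [^] m)) + real (N (a [^] n)) \<le> real (N (a [^] (m + n))) + 2 * (\<kappa> + 2 * \<delta>)" for m n :: nat
  proof (cases n)
    case 0
    then show ?thesis using k0 delta_nonneg by simp
  next
    case (Suc n')
    let ?y = "a [^] m" and ?z = "a [^] Suc m" and ?w = "a [^] (m + n)"
    have 1: "gp ?y \<one> ?z \<le> \<kappa> + \<delta>" using lox_chain(1)[OF assms, of m] by (simp add: \<kappa>_def)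
    have dz: "d ?z ?y = N a" using d_pow[OF a, of m "Suc m"] d_commute[of ?z ?y] a by simp
    have dw: "d ?w ?y = N (a [^] n)" using d_pow[OF a, of m "m + n"] d_commute[of ?w ?y] a by simp
    have "d ?w ?z = N (a [^] n')" using d_pow[OF a, of "Suc m" "m + n"] d_commute[of ?w ?z] a Suc by simp
    then have "2 * gp ?y ?w ?z = real (N (a [^] Suc n')) + real (N a) - real (N (a [^] n'))"
      using dz dw Suc by (simp add: gromov_prod_def del: nat_pow_Suc)
    moreover have "real (N (a [^] Suc n')) \<ge> real (N (a [^] n')) + real (N a) - 2 * \<kappa> - 2 * \<delta>"
      using lox_chain(2)[OF assms, of n'] by (simp only: \<kappa>_def)
    moreover have "real (N a) - \<kappa> - \<delta> > \<kappa> + 2 * \<delta>" using assms by (simp add: \<kappa>_def lox_def)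
    ultimately have 2: "gp ?y ?w ?z > \<kappa> + 2 * \<delta>" by linarith
    have "gp ?y \<one> ?w \<le> \<kappa> + 2 * \<delta>"
    proof (rule ccontr)
      assume 3: "\<not> ?thesis"
      then have "min (gp ?y \<one> ?w) (gp ?y ?w ?z) - \<delta> \<le> gp ?y \<one> ?z"
        using a by (intro hyp) auto
      then show False using 1 2 3 by (simp add: min_def split: if_splits)
    qed
    then show ?thesis using dw a by (simp add: gromov_prod_def)
  qed
  then show ?thesis using that[of "\<kappa> + 2 * \<delta>"] k0 delta_nonneg by auto
qed

lemma lox_growth_pos:
  assumes "lox a"
  obtains e where "0 < e" "\<And>n::nat. real (N (a [^] n)) \<ge> real n * e"
proof
  show "0 < real (N (a [^] (2::nat))) - real (N a) - 2 * \<delta>" using assms delta_nonneg by (simp add: lox_def)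
qed (rule lox_growth[OF assms])

lemma lox_infinite_order: "lox a \<Longrightarrow> infinite_order G a"
  unfolding infinite_order_def
proof (intro allI impI notI)
  fix n :: nat assume a: "lox a" "0 < n" "a [^] n = \<one>"
  obtain e where e: "0 < e" "\<And>n::nat. real (N (a [^] n)) \<ge> real n * e"
    using lox_growth_pos[OF a(1)] by blast
  then have "0 < real n * e" using a by simp
  then show False using e(2)[of n] a(3) by simp
qed

lemma linear_growth_imp_square:
  assumes "a \<in> carrier G" "0 \<le> e" "\<And>n::nat. real (N (a [^] n)) \<le> real n * e + c"
  shows "real (N (a [^] (2::nat))) \<le> real (N a) + 3 * \<delta> + e"
proof (rule ccontr)
  assume *: "\<not> ?thesis"
  then have "lox a" using assms by (simp add: lox_def)
  have "real (N (a [^] (2::nat))) - real (N a) - 2 * \<delta> \<le> e"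
  proof (rule archimedean_le[of _ _ c])
    fix n :: nat
    show "real n * (real (N (a [^] (2::nat))) - real (N a) - 2 * \<delta>) \<le> real n * e + c"
      using lox_growth[OF \<open>lox a\<close>, of n] assms(3)[of n] by linarith
  qed
  then show False using * delta_nonneg by simp
qed

text \<open>The midpoint of a geodesic from \<open>\<one>\<close> to \<open>a\<close> is displaced little by \<open>a\<close>.\<close>

lemma small_displacement:
  assumes a: "a \<in> carrier G" and "0 \<le> e" "real (N (a [^] (2::nat))) \<le> real (N a) + e"
  shows "\<exists>g\<in>carrier G. d g (a \<otimes> g) \<le> 1 + e + 4 * \<delta>"
proof -
  obtain f :: "nat \<Rightarrow> 'a" and L where f: "\<And>i. f i \<in> carrier G" "f 0 = \<one>" "f L = a" "d \<one> a = L"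
    "\<And>i j. i \<le> j \<Longrightarrow> j \<le> L \<Longrightarrow> d (f i) (f j) = real j - real i"
    using discrete_geodesic[of \<one> a] a by auto
  define g where "g = f (L div 2)"
  have g: "g \<in> carrier G" using f by (simp add: g_def)
  have L: "L = N a" using f a by simp
  have h: "real (L div 2) \<le> real L / 2" "real (L div 2) \<ge> real L / 2 - 1 / 2" by linarith+
  have g1: "d \<one> g = real (L div 2)" using f(5)[of 0 "L div 2"] f(2) by (simp add: g_def)
  have g2: "d g a = L - real (L div 2)" using f(5)[of "L div 2" L] f(3) by (simp add: g_def)
  have ag: "d a (a \<otimes> g) = real (L div 2)" "d (a \<otimes> g) (a \<otimes> a) = L - real (L div 2)"
    "d a (a \<otimes> a) = L"
    using g1 g2 d_left_mult[of \<one> g a] d_left_mult[of g a a] d_left_mult[of \<one> a a] a g L by simp_all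
  have aa: "d \<one> (a \<otimes> a) = N (a [^] (2::nat))" using a by (simp add: numeral_2_eq_2)
  \<comment> \<open>The chain \<open>g\<close>, \<open>\<one>\<close>, \<open>a \<otimes> a\<close>,
    \<open>a \<otimes> g\<close> is viewed from \<open>a\<close>: the outer products come from
    points on a geodesic side, the middle one from the bound on \<open>|a\<^sup>2|\<close>. The 1
    pays for the rounding in \<open>L div 2\<close>.\<close>
  have "(real L - 1 - e) / 2 - 2 * \<delta> \<le> gp a g (a \<otimes> g)"
  proof (rule hyp_ge2[of a g \<one> "a \<otimes> a" "a \<otimes> g"])
    show "(real L - 1 - e) / 2 \<le> gp a g \<one>"
      using g1 g2 h L a g d_commute[of g \<one>] assms(2) by (simp add: gromov_prod_def field_simps)
    show "(real L - 1 - e) / 2 \<le> gp a \<one> (a \<otimes> a)"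
      using aa ag assms L a d_commute[of "a \<otimes> a" a] by (simp add: gromov_prod_def field_simps)
    show "(real L - 1 - e) / 2 \<le> gp a (a \<otimes> a) (a \<otimes> g)"
      using ag h assms(2) a g d_commute[of "a \<otimes> a" a] d_commute[of "a \<otimes> g" a] d_commute[of "a \<otimes> g" "a \<otimes> a"]
      by (simp add: gromov_prod_def field_simps)
  qed (use a g in auto)
  moreover have "gp a g (a \<otimes> g) = (real L - d g (a \<otimes> g)) / 2"
    using g2 ag a g d_commute[of "a \<otimes> g" a] by (simp add: gromov_prod_def)
  ultimately have "d g (a \<otimes> g) \<le> 1 + e + 4 * \<delta>" by (simp add: field_simps)
  then show ?thesis using g by blast
qed

end

section \<open>Independent loxodromic elements\<close>

lemma (in group) intertwine_pow:
  assumes "g \<in> carrier G" "x \<in> carrier G" "y \<in> carrier G" "g \<otimes> x = y \<otimes> g"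
  shows "g \<otimes> x [^] (n::nat) = y [^] n \<otimes> g"
proof (induction n)
  case (Suc n)
  have "g \<otimes> x [^] Suc n = y [^] n \<otimes> (g \<otimes> x)"
    using Suc assms(1-3) by (simp add: m_assoc[symmetric])
  then show ?case using assms by (simp add: m_assoc)
qed (use assms in simp)

context word_metric
begin

text \<open>The label \<open>c n\<close> makes finitely many discrete choices, such as the signs of
  exponents, coincide along with the bounded element.\<close>

lemma pigeonhole_ball:
  assumes F: "finite F" and "\<And>n::nat. c n \<in> F" "\<And>n. y n \<in> carrier G" "\<And>n. real (N (y n)) \<le> r"
  obtains m n where "m < n" "c m = c n" "y m = y n"
proof -
  have "(\<lambda>n. (c n, y n)) ` UNIV \<subseteq> F \<times> {g \<in> carrier G. real (N g) \<le> r}"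
    using assms by auto
  then have "finite ((\<lambda>n. (c n, y n)) ` UNIV)"
    using finite_cartesian_product[OF F finite_ball] finite_subset by blast
  then have "\<not> inj (\<lambda>n. (c n, y n))" using finite_imageD infinite_UNIV_nat by blast
  then obtain m n where "m \<noteq> n" "c m = c n" "y m = y n" by (auto simp: inj_def)
  then show ?thesis using that by (metis nat_neq_iff)
qed

text \<open>Word length changes by at most |a| from one power to the next, so the first power that
  reaches the level r overshoots it by at most |a|.\<close>

lemma N_pow_first_ge:
  fixes r :: real
  assumes "a \<in> carrier G" "r \<le> real (N (a [^] (n::nat)))" "0 \<le> r"
  obtains j :: nat where "j \<le> n" "r \<le> N (a [^] j)" "N (a [^] j) \<le> r + N a"
proof -
  define j where "j = (LEAST j::nat. r \<le> N (a [^] j))"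
  have j: "r \<le> N (a [^] j)" unfolding j_def using assms(2) by (rule LeastI)
  have jn: "j \<le> n" unfolding j_def using assms(2) by (rule Least_le)
  have "N (a [^] j) \<le> r + N a"
  proof (cases j)
    case 0
    then show ?thesis using assms by simp
  next
    case (Suc i)
    then have "\<not> r \<le> N (a [^] i)" using not_less_Least[of i "\<lambda>j::nat. r \<le> N (a [^] j)"] by (simp add: j_def)
    then show ?thesis using N_mult[of "a [^] i" a] assms(1) Suc by simp
  qed
  then show ?thesis using that j jn by blast
qed

end

context hyp_group
begin

lemma gp_le: "w \<in> carrier G \<Longrightarrow> x \<in> carrier G \<Longrightarrow> y \<in> carrier G \<Longrightarrow> gp w x y \<le> d x w"
  using d_triangle[of y x w] d_commute[of x y] by (simp add: gromov_prod_def)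

lemma gp_left_mult [simp]:
  "k \<in> carrier G \<Longrightarrow> w \<in> carrier G \<Longrightarrow> x \<in> carrier G \<Longrightarrow> y \<in> carrier G \<Longrightarrow>
    gp (k \<otimes> w) (k \<otimes> x) (k \<otimes> y) = gp w x y"
  by (simp add: gromov_prod_def)

lemma gp_move:
  assumes "w \<in> carrier G" "x \<in> carrier G" "y \<in> carrier G" "z \<in> carrier G"
  shows "gp w x y \<le> gp w x z + d y z"
  using d_triangle[of y z w] d_triangle[of x y z] assms by (simp add: gromov_prod_def field_simps)

text \<open>Near-additivity says that \<open>a [^] j\<close> lies on the way from
  \<open>\<one>\<close> to \<open>a [^] n\<close>, here in the form that \<open>close_of_gp\<close>
  asks for.\<close>

lemma gp_pow:
  assumes "a \<in> carrier G" "j \<le> n"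
    and "\<And>m n::nat. real (N (a [^] m)) + real (N (a [^] n)) \<le> real (N (a [^] (m + n))) + 2 * k"
  shows "gp \<one> (a [^] j) (a [^] (n::nat)) \<ge> real (N (a [^] j)) - k"
  using assms(3)[of j "n - j"] d_pow[OF assms(1,2)] assms(1,2) by (simp add: gromov_prod_def)

text \<open>Two quasi-geodesic rays with a common end fellow travel, so the elements
  \<open>u\<^sup>-\<^sup>j g v\<^sup>T\<close> stay in a finite ball and two of them coincide.\<close>

lemma unbounded_gp_imp_intertwine:
  assumes b: "lox b" and g: "g \<in> carrier G"
    and unbounded: "\<And>M. \<exists>u\<in>{b, inv b}. \<exists>v\<in>{b, inv b}. \<exists>(n::nat) (m::nat). gp \<one> (u [^] n) (g \<otimes> v [^] m) > M"
  shows "\<exists>e::nat. 0 < e \<and> (\<exists>q::int. g \<otimes> b [^] e = b [^] q \<otimes> g)"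
proof -
  have bc: "b \<in> carrier G" using b lox_carrier by blast
  obtain k where k: "0 \<le> k"
    "\<And>m n::nat. real (N (b [^] m)) + real (N (b [^] n)) \<le> real (N (b [^] (m + n))) + 2 * k"
    using lox_additive[OF b] by blast
  have bb: "u \<in> carrier G" "N u = N b" "\<And>n::nat. N (u [^] n) = N (b [^] n)" if "u \<in> {b, inv b}" for u
    using that bc by (auto simp: N_pow_inv)
  have ku: "real (N (u [^] m)) + real (N (u [^] n)) \<le> real (N (u [^] (m + n))) + 2 * k"
    if "u \<in> {b, inv b}" for u and m n :: nat
    using k(2) bb(3)[OF that] by simp
  \<comment> \<open>k for the powers as a quasi-geodesic, |g| because the ray of the points
    \<open>g \<otimes> v [^] m\<close> starts at g, and \<delta> for passing to the other
    ray.\<close>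
  define K where "K = k + N g + \<delta>"
  define R where "R = N b + 2 * K + 2 * \<delta>"
  have "\<exists>u v j. u \<in> {b, inv b} \<and> v \<in> {b, inv b} \<and> d (u [^] (j::nat)) (g \<otimes> v [^] (T::nat)) \<le> R" for T
  proof -
    \<comment> \<open>Large enough that both rays run past \<open>g \<otimes> v [^] T\<close>: M
      bounds the length of this point and is exceeded by the lengths of \<open>u [^] n\<close> and
      \<open>g \<otimes> v [^] m\<close>, which also forces \<open>T \<le> m\<close>.\<close>
    define M where "M = real (N g) + real T * real (N b)"
    obtain u v and n m :: nat where uv: "u \<in> {b, inv b}" "v \<in> {b, inv b}"
      and M: "gp \<one> (u [^] n) (g \<otimes> v [^] m) > M"
      using unbounded[of M] by (elim bexE exE) (rule that)
    note u = bb[OF uv(1)] and v = bb[OF uv(2)]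
    let ?y = "g \<otimes> v [^] T" and ?e = "u [^] n" and ?f = "g \<otimes> v [^] m"
    have "real (N ?y) \<le> N g + N (v [^] T)" using N_mult[of g "v [^] T"] g v by simp
    then have LT: "real (N ?y) \<le> N g + real (N (v [^] T))" "real (N ?y) \<le> M"
      using N_pow_le[OF v(1), of T] v(2) by (auto simp: M_def of_nat_mult[symmetric] simp del: of_nat_mult)
    have Mf: "M < N ?f"
      using gp_le[of \<one> ?f ?e] gp_sym[of ?f ?e \<one>] M g u v by simp
    have Me: "M < N ?e"
      using gp_le[of \<one> ?e ?f] M g u v by simp
    have "N ?f \<le> N g + m * N b"
      using N_mult[of g "v [^] m"] N_pow_le[OF v(1), of m] g v by simp
    then have "real (N ?f) \<le> real (N g + m * N b)" by (simp only: of_nat_le_iff)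
    then have "T * N b < m * N b" using Mf unfolding M_def of_nat_less_iff[symmetric, where 'a=real] by simp
    then have Tm: "T \<le> m" by simp
    \<comment> \<open>The power of u at about the same distance from \<open>\<one>\<close> as
      \<open>g \<otimes> v [^] T\<close>.\<close>
    obtain j where j: "j \<le> n" "real (N ?y) \<le> N (u [^] j)" "N (u [^] j) \<le> real (N ?y) + N u"
      using N_pow_first_ge[OF u(1), of "real (N ?y)" n] LT Me by auto
    have "d ?y ?f = N (v [^] (m - T))" using d_pow[OF v(1) Tm] g v by simp
    moreover have "real (N (v [^] m)) \<le> N g + real (N ?f)"
      using N_mult[of "inv g" ?f] g v by simp
    moreover have "real (N (v [^] T)) + real (N (v [^] (m - T))) \<le> real (N (v [^] m)) + 2 * k"
      using ku[OF uv(2), of T "m - T"] Tm by simp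
    ultimately have yf: "gp \<one> ?y ?f \<ge> N ?y - k - N g"
      using LT(1) g v by (simp add: gromov_prod_def)
    have "gp \<one> ?y ?e \<ge> N ?y - k - N g - \<delta>"
      using yf M LT(2) k(1) g u v gp_sym[of ?f ?e \<one>] by (intro hyp_ge[of \<one> ?y ?f ?e]) auto
    then have "gp \<one> ?y ?e \<ge> d \<one> ?y - K" using g v by (simp add: K_def)
    moreover have "gp \<one> (u [^] j) ?e \<ge> d \<one> (u [^] j) - K"
      using gp_pow[OF u(1) j(1) ku[OF uv(1)]] u(1) delta_nonneg by (simp add: K_def)
    ultimately have "d (u [^] j) ?y \<le> N u + 2 * K + 2 * \<delta>"
      using g u v j by (intro close_of_gp[of \<one> "u [^] j" ?y ?e]) auto
    then show ?thesis unfolding R_def using uv u(2) by auto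
  qed
  then obtain u v and j :: "nat \<Rightarrow> nat" where uv: "\<And>T. u T \<in> {b, inv b}" "\<And>T. v T \<in> {b, inv b}"
    and R: "\<And>T. d (u T [^] j T) (g \<otimes> v T [^] T) \<le> R"
    by metis
  have uvc: "u T \<in> carrier G" "v T \<in> carrier G" for T using uv bb by blast+
  obtain m n where mn: "m < n" "(u m, v m) = (u n, v n)"
    "inv (u m [^] j m) \<otimes> (g \<otimes> v m [^] m) = inv (u n [^] j n) \<otimes> (g \<otimes> v n [^] n)"
  proof (rule pigeonhole_ball[of "{b, inv b} \<times> {b, inv b}" "\<lambda>T. (u T, v T)"
        "\<lambda>T. inv (u T [^] j T) \<otimes> (g \<otimes> v T [^] T)" R])
    show "real (N (inv (u T [^] j T) \<otimes> (g \<otimes> v T [^] T))) \<le> R" for T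
      using R[of T] by (simp add: word_dist_def)
  qed (use uv uvc g in auto)
  define U V where "U = u m" and "V = v m"
  have UV: "U \<in> carrier G" "V \<in> carrier G" and Ub: "U = b \<or> U = inv b" and Vb: "V = b \<or> V = inv b"
    using uvc uv by (auto simp: U_def V_def)
  have eq: "inv (U [^] j m) \<otimes> (g \<otimes> V [^] m) = inv (U [^] j n) \<otimes> (g \<otimes> V [^] n)"
    using mn by (simp add: U_def V_def)
  define e where "e = n - m"
  define q where "q = int (j n) - int (j m)"
  have "V [^] n = V [^] e \<otimes> V [^] m"
    using mn(1) UV nat_pow_mult[of V e m] by (simp add: e_def)
  then have "g \<otimes> V [^] e \<otimes> V [^] m = U [^] j n \<otimes> (inv (U [^] j n) \<otimes> (g \<otimes> V [^] n))"
    using UV g by (simp add: m_assoc)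
  also have "\<dots> = U [^] q \<otimes> g \<otimes> V [^] m"
    using eq[symmetric] UV g by (simp add: m_assoc q_def int_pow_diff int_pow_int)
  finally have ge: "g \<otimes> V [^] e = U [^] q \<otimes> g" using UV g by simp
  \<comment> \<open>U and V are b or its inverse; the signs are absorbed into the integer exponent
    of b.\<close>
  have Uq: "\<exists>q'::int. U [^] q = b [^] q'"
    using Ub bc int_pow_inv[OF bc, of q] int_pow_neg[OF bc, of q] by metis
  have "\<exists>q'::int. g \<otimes> b [^] e = b [^] q' \<otimes> g"
  proof (cases "V = b")
    case True
    then show ?thesis using ge Uq by metis
  next
    case False
    then have "g \<otimes> inv (b [^] e) = U [^] q \<otimes> g" using ge Vb bc by (simp add: nat_pow_inv)
    then have "U [^] q \<otimes> (g \<otimes> b [^] e) = g \<otimes> inv (b [^] e) \<otimes> b [^] e"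
      using g bc UV by (simp add: m_assoc[symmetric])
    then have "U [^] q \<otimes> (g \<otimes> b [^] e) = g" using g bc by (simp add: m_assoc)
    then have "g \<otimes> b [^] e = inv (U [^] q) \<otimes> g"
      using g bc UV inv_solve_left[of "g \<otimes> b [^] e" "U [^] q" g] by simp
    then show ?thesis using Uq int_pow_neg[OF bc] by metis
  qed
  then show ?thesis using mn(1) by (auto simp: e_def intro!: exI[of _ e])
qed

text \<open>If \<open>p > e\<close>, near-additivity makes \<open>|b^(pn)| - |b^(en)|\<close> at
  least \<open>|b^((p-e)n)| - 2k\<close>, which grows linearly in n.\<close>

lemma lox_pow_growth_le:
  assumes b: "lox b" and "\<And>n::nat. real (N (b [^] (p * n))) \<le> real (N (b [^] (e * n))) + c"
  shows "p \<le> e"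
proof (rule ccontr)
  assume "\<not> p \<le> e"
  obtain k where k: "0 \<le> k"
    "\<And>m n::nat. real (N (b [^] m)) + real (N (b [^] n)) \<le> real (N (b [^] (m + n))) + 2 * k"
    using lox_additive[OF b] by blast
  obtain t where t: "0 < t" "\<And>n::nat. real (N (b [^] n)) \<ge> real n * t"
    using lox_growth_pos[OF b] by blast
  have "real n * t \<le> real n * 0 + (c + 2 * k)" for n
  proof -
    have "n \<le> (p - e) * n" using \<open>\<not> p \<le> e\<close> by (cases "p - e") auto
    then have "real n * t \<le> real ((p - e) * n) * t"
      using t(1) by (intro mult_right_mono of_nat_mono) auto
    also have "\<dots> \<le> N (b [^] ((p - e) * n))" using t(2) by blast
    also have "\<dots> \<le> N (b [^] (p * n)) + 2 * k - N (b [^] (e * n))"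
      using k(2)[of "e * n" "(p - e) * n"] \<open>\<not> p \<le> e\<close> by (simp flip: add_mult_distrib)
    finally show ?thesis using assms(2)[of n] by simp
  qed
  then have "t \<le> 0" by (rule archimedean_le)
  then show False using t(1) by simp
qed

text \<open>Conjugation by g alters lengths by at most 2|g|, so b^(en) and b^(qn) grow at the same
  rate and |q| = e. Thus g either centralises or inverts \<open>b [^] e\<close>; squaring settles
  the second case.\<close>

lemma intertwine_imp_commute_square:
  assumes b: "lox b" and g: "g \<in> carrier G" and e: "0 < (e::nat)" and eq: "g \<otimes> b [^] e = b [^] (q::int) \<otimes> g"
  shows "(g \<otimes> g) \<otimes> b [^] e = b [^] e \<otimes> (g \<otimes> g)"
proof -
  have bc: "b \<in> carrier G" using b lox_carrier by blast
  have N_abs: "N (b [^] i) = N (b [^] nat \<bar>i\<bar>)" for i :: int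
    using bc int_pow_int[of G b "nat \<bar>i\<bar>"] int_pow_neg[OF bc, of i] by (cases "0 \<le> i") (simp_all add: int_pow_neg)
  have conj: "g \<otimes> b [^] (e * n) = b [^] (q * int n) \<otimes> g" for n
    using intertwine_pow[OF g _ _ eq, of n] bc nat_pow_pow[OF bc, of e n] int_pow_pow[OF bc, of q "int n"]
    by (simp add: int_pow_int)
  have "nat \<bar>q * int n\<bar> = nat \<bar>q\<bar> * n" for n by (simp add: abs_mult nat_mult_distrib)
  then have Nq: "N (b [^] (q * int n)) = N (b [^] (nat \<bar>q\<bar> * n))" for n using N_abs[of "q * int n"] by simp
  have "real (N (b [^] (nat \<bar>q\<bar> * n))) \<le> real (N (b [^] (e * n))) + 2 * N g" for n
  proof -
    have "b [^] (q * int n) = g \<otimes> b [^] (e * n) \<otimes> inv g" using conj[of n] g bc by (simp add: m_assoc)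
    then show ?thesis
      using Nq[of n] N_mult[of "g \<otimes> b [^] (e * n)" "inv g"] N_mult[of g "b [^] (e * n)"] g bc by simp
  qed
  then have 1: "nat \<bar>q\<bar> \<le> e" by (rule lox_pow_growth_le[OF b])
  have "real (N (b [^] (e * n))) \<le> real (N (b [^] (nat \<bar>q\<bar> * n))) + 2 * N g" for n
  proof -
    have "b [^] (e * n) = inv g \<otimes> (b [^] (q * int n) \<otimes> g)" using conj[of n, symmetric] g bc by simp
    then show ?thesis
      using Nq[of n] N_mult[of "inv g" "b [^] (q * int n) \<otimes> g"] N_mult[of "b [^] (q * int n)" g] g bc by simp
  qed
  then have 2: "e \<le> nat \<bar>q\<bar>" by (rule lox_pow_growth_le[OF b])
  have qe: "q = int e \<or> q = - int e" using 1 2 by linarith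
  let ?z = "b [^] e"
  have zc: "?z \<in> carrier G" using bc by simp
  show ?thesis
  proof (cases "q = int e")
    case True
    then have "g \<otimes> ?z = ?z \<otimes> g" using eq by (simp add: int_pow_int)
    then show ?thesis using g zc by (metis m_assoc m_closed)
  next
    case False
    then have 3: "g \<otimes> ?z = inv ?z \<otimes> g" using eq qe bc by (simp add: int_pow_neg int_pow_int)
    then have "?z \<otimes> (g \<otimes> ?z) = g" using g zc by simp
    then have "g \<otimes> inv ?z = ?z \<otimes> g" using g zc inv_solve_right'[of "?z \<otimes> g" g ?z]
      by (metis inv_solve_right m_assoc m_closed)
    then show ?thesis using 3 g zc by (metis inv_closed m_assoc)
  qed
qed

text \<open>With z = b^r, the points g z^n and z^n are |g| apart, and likewise for the inverse
  powers. For n large compared with |g|, the element g therefore lies nearly between z^(-n) and z^n,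
  and some power of z is near it. That R is the same for all g is what the pigeonhole of
  \<open>commute_pow_imp_common_power\<close> needs.\<close>

lemma commute_pow_imp_close:
  assumes b: "lox b" and r: "0 < (r::nat)"
  obtains R where "\<And>g. g \<in> carrier G \<Longrightarrow> g \<otimes> b [^] r = b [^] r \<otimes> g \<Longrightarrow> \<exists>q::int. d (b [^] q) g \<le> R"
proof -
  have bc: "b \<in> carrier G" using b lox_carrier by blast
  define z where "z = b [^] r"
  have zc: "z \<in> carrier G" using bc by (simp add: z_def)
  obtain k where k: "0 \<le> k"
    "\<And>m n::nat. real (N (b [^] m)) + real (N (b [^] n)) \<le> real (N (b [^] (m + n))) + 2 * k"
    using lox_additive[OF b] by blast
  obtain t where t: "0 < t" "\<And>n::nat. real (N (b [^] n)) \<ge> real n * t"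
    using lox_growth_pos[OF b] by blast
  have kz: "real (N (z [^] m)) + real (N (z [^] n)) \<le> real (N (z [^] (m + n))) + 2 * k" for m n :: nat
    using k(2)[of "r * m" "r * n"] bc by (simp add: z_def nat_pow_pow distrib_left)
  define R where "R = N z + 2 * (k + 2 * \<delta>) + 2 * \<delta>"
  have "\<exists>q::int. d (b [^] q) g \<le> R" if g: "g \<in> carrier G" and com: "g \<otimes> z = z \<otimes> g" for g
  proof -
    \<comment> \<open>n may depend on g. The margin makes the product at g of
      \<open>g \<otimes> z [^] n\<close> and \<open>z [^] n\<close> exceed k + 2\<delta>, and lets
      the powers counted from \<open>inv (z [^] n)\<close> reach past g.\<close>
    obtain n :: nat where n: "real n * t > 2 * N g + 4 * k + 8 * \<delta>" using reals_Archimedean3[OF t(1)] by blast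
    have "n \<le> r * n" using r by (cases r) auto
    then have "real n * t \<le> real (r * n) * t" using t(1) by (intro mult_right_mono of_nat_mono) auto
    also have "\<dots> \<le> N (z [^] n)" using t(2)[of "r * n"] bc by (simp add: z_def nat_pow_pow)
    finally have big: "N (z [^] n) > 2 * N g + 4 * k + 8 * \<delta>" using n by linarith
    define zp zm where "zp = z [^] n" and "zm = inv (z [^] n)"
    have c: "zp \<in> carrier G" "zm \<in> carrier G" using zc by (simp_all add: zp_def zm_def)
    have NN: "N zp = N (z [^] n)" "N zm = N (z [^] n)" using zc by (simp_all add: zp_def zm_def)
    have comp: "g \<otimes> zp = zp \<otimes> g" using intertwine_pow[OF g zc zc com] by (simp add: zp_def)
    have comm: "g \<otimes> zm = zm \<otimes> g"
      using comp c g zc by (metis inv_solve_left inv_solve_right' m_assoc m_closed zm_def zp_def)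
    have zz: "zm \<otimes> z [^] (2 * n) = zp"
      using zc unfolding mult_2 by (simp add: zm_def zp_def nat_pow_mult[OF zc, symmetric])
    have dzz: "d zm zp = N (z [^] (2 * n))" using d_right_mult[of zm "z [^] (2 * n)"] zz c zc by simp
    have 1: "gp g (g \<otimes> zm) (g \<otimes> zp) \<le> k"
    proof -
      have "gp g (g \<otimes> zm) (g \<otimes> zp) = gp \<one> zm zp" using gp_left_mult[of g \<one> zm zp] c g by simp
      also have "\<dots> = (real (N (z [^] n)) + real (N (z [^] n)) - real (N (z [^] (2 * n)))) / 2"
        using c by (simp add: gromov_prod_def dzz NN)
      also have "real (N (z [^] n)) + real (N (z [^] n)) \<le> real (N (z [^] (2 * n))) + 2 * k"
        using kz[of n n] by (simp only: mult_2)
      finally show ?thesis by simp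
    qed
    have tri: "N x \<le> d x g + N g" if "x \<in> carrier G" for x
      using d_triangle[of x g \<one>] that g by simp
    have 2: "gp g (g \<otimes> x) x \<ge> real (N x) - real (N g)" if "x \<in> carrier G" "g \<otimes> x = x \<otimes> g" for x
    proof -
      have "d (g \<otimes> x) x = N g" using that g d_left_mult[of g \<one> x] by simp
      moreover have "d (g \<otimes> x) g = N x" using that g d_left_mult[of x \<one> g] by simp
      ultimately show ?thesis using tri[of x] that by (simp add: gromov_prod_def)
    qed
    \<comment> \<open>Otherwise the chain \<open>g \<otimes> zm\<close>, \<open>zm\<close>,
      \<open>zp\<close>, \<open>g \<otimes> zp\<close> would make the product in fact 1 exceed
      k.\<close>
    have 3: "gp g zm zp \<le> k + 2 * \<delta>"
    proof (rule ccontr)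
      assume *: "\<not> ?thesis"
      define t where "t = min (real (N (z [^] n)) - real (N g)) (gp g zm zp)"
      have "t - 2 * \<delta> \<le> gp g (g \<otimes> zm) (g \<otimes> zp)"
        using 2[OF c(1) comp] 2[OF c(2) comm] NN c g gp_sym[of zp "g \<otimes> zp" g]
        by (intro hyp_ge2[of g "g \<otimes> zm" zm zp "g \<otimes> zp"]) (auto simp: t_def)
      moreover have "t > k + 2 * \<delta>" using * big k(1) delta_nonneg by (simp add: t_def)
      ultimately show False using 1 by simp
    qed
    have "d zm g + d zp g = d zm zp + 2 * gp g zm zp" by (simp add: gromov_prod_def field_simps)
    then have "d zm g \<le> N (z [^] (2 * n))" using 3 dzz tri[of zp] big NN c delta_nonneg k(1) by simp
    then obtain j where j: "j \<le> 2 * n" "d zm g \<le> N (z [^] j)" "N (z [^] j) \<le> d zm g + N z"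
      using N_pow_first_ge[OF zc] d_nonneg by metis
    have dj: "d zm (zm \<otimes> z [^] j) = N (z [^] j)" using d_right_mult c zc by simp
    have "gp zm (zm \<otimes> z [^] j) zp = gp \<one> (z [^] j) (z [^] (2 * n))"
      using gp_left_mult[of zm \<one> "z [^] j" "z [^] (2 * n)"] zz c zc by simp
    then have "gp zm (zm \<otimes> z [^] j) zp \<ge> d zm (zm \<otimes> z [^] j) - (k + 2 * \<delta>)"
      using gp_pow[OF zc j(1) kz] dj delta_nonneg by simp
    moreover have "gp zm g zp \<ge> d zm g - (k + 2 * \<delta>)"
      using 3 gp_swap_base[of g zm zp] d_commute[of g zm] c g by simp
    ultimately have "d (zm \<otimes> z [^] j) g \<le> N z + 2 * (k + 2 * \<delta>) + 2 * \<delta>"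
      using c g zc j dj by (intro close_of_gp[of zm "zm \<otimes> z [^] j" g zp]) auto
    moreover have "zm \<otimes> z [^] j = b [^] (- int (r * n) + int (r * j))"
      using bc unfolding int_pow_mult[OF bc] int_pow_neg[OF bc]
      by (simp add: zm_def z_def nat_pow_pow int_pow_int del: of_nat_mult)
    ultimately show ?thesis unfolding R_def by metis
  qed
  then show ?thesis using that z_def by blast
qed

text \<open>All powers of w commute with \<open>b [^] r\<close> and so stay near powers of b; two of
  the bounded differences coincide.\<close>

lemma commute_pow_imp_common_power:
  assumes b: "lox b" and r: "0 < (r::nat)" and w: "w \<in> carrier G" "w \<otimes> b [^] r = b [^] r \<otimes> w"
  shows "\<exists>i::nat. 0 < i \<and> (\<exists>q::int. w [^] i = b [^] q)"
proof -
  have bc: "b \<in> carrier G" using b lox_carrier by blast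
  obtain R where R: "\<And>g. g \<in> carrier G \<Longrightarrow> g \<otimes> b [^] r = b [^] r \<otimes> g \<Longrightarrow> \<exists>q::int. d (b [^] q) g \<le> R"
    using commute_pow_imp_close[OF b r] by blast
  have "w [^] n \<otimes> b [^] r = b [^] r \<otimes> w [^] n" for n :: nat
    using group_commutes_pow[OF w(2,1)] bc by simp
  then have "\<exists>q::int. d (b [^] q) (w [^] n) \<le> R" for n :: nat using R w by simp
  then obtain q :: "nat \<Rightarrow> int" where q: "\<And>n. d (b [^] q n) (w [^] n) \<le> R" by metis
  obtain m n where mn: "m < n" "inv (b [^] q m) \<otimes> w [^] m = inv (b [^] q n) \<otimes> w [^] n"
  proof (rule pigeonhole_ball[of UNIV "\<lambda>_. ()" "\<lambda>n. inv (b [^] q n) \<otimes> w [^] n" R])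
    show "real (N (inv (b [^] q n) \<otimes> w [^] n)) \<le> R" for n using q[of n] by (simp add: word_dist_def)
  qed (use w bc in auto)
  have "w [^] (n - m) \<otimes> w [^] m = w [^] n" using mn(1) w nat_pow_mult[of w "n - m" m] by simp
  also have "\<dots> = b [^] q n \<otimes> (inv (b [^] q n) \<otimes> w [^] n)" using w bc by simp
  also have "\<dots> = b [^] (q n - q m) \<otimes> w [^] m"
    using w bc unfolding mn(2)[symmetric] by (simp add: int_pow_diff m_assoc)
  finally have "w [^] (n - m) = b [^] (q n - q m)" using w bc by simp
  then show ?thesis using mn(1) by (intro exI[of _ "n - m"]) auto
qed

end

lemma freely_reduced_replicate: "freely_reduced (replicate n x)"
  by (simp add: freely_reduced_def)

lemma freely_reduced_append:
  assumes "freely_reduced u" "freely_reduced v" "u \<noteq> []" "v \<noteq> []" "fst (last u) \<noteq> fst (hd v)"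
  shows "freely_reduced (u @ v)"
  unfolding freely_reduced_def
proof (intro allI impI)
  fix i assume i: "Suc i < length (u @ v)"
  consider "Suc i < length u" | "Suc i = length u" | "length u \<le> i" by linarith
  then show "\<not> (fst ((u @ v) ! i) = fst ((u @ v) ! Suc i) \<and> snd ((u @ v) ! i) \<noteq> snd ((u @ v) ! Suc i))"
  proof cases
    case 1
    then show ?thesis using assms(1) by (simp add: nth_append freely_reduced_def)
  next
    case 2
    then have "last u = u ! i" "hd v = v ! 0" using assms by (simp_all add: last_conv_nth hd_conv_nth flip: 2)
    then show ?thesis using assms(5) 2 by (simp add: nth_append)
  next
    case 3
    then have "Suc (i - length u) < length v" "Suc i - length u = Suc (i - length u)" using i by auto
    then show ?thesis using assms(2) 3 by (simp add: nth_append freely_reduced_def)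
  qed
qed

lemma (in word_metric) eval_word_replicate:
  "s \<in> carrier G \<Longrightarrow> eval_word G (replicate n (s, b)) = (if b then s else inv s) [^] n"
  by (induction n) (simp_all add: eval_word_Nil eval_word_Cons nat_pow_Suc2[symmetric] del: nat_pow_Suc)

text \<open>The commutator of the two powers is a nonempty reduced word in x and y.\<close>

lemma (in word_metric) not_commuting_powers:
  assumes ne: "\<And>w :: (bool \<times> bool) list. w \<noteq> [] \<Longrightarrow> freely_reduced w \<Longrightarrow>
      eval_word G (map (\<lambda>(i, e). (if i then x else y, e)) w) \<noteq> \<one>"
    and xy: "x \<in> carrier G" "y \<in> carrier G" and ij: "0 < i" "0 < j"
  shows "x [^] (i::nat) \<otimes> y [^] (j::nat) \<noteq> y [^] j \<otimes> x [^] i"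
proof
  assume com: "x [^] i \<otimes> y [^] j = y [^] j \<otimes> x [^] i"
  define w where "w = replicate i (True, True) @ replicate j (False, True) @
    replicate i (True, False) @ replicate j (False, False)"
  have "freely_reduced w"
    unfolding w_def using ij by (intro freely_reduced_append freely_reduced_replicate) auto
  moreover have "w \<noteq> []" using ij by (simp add: w_def)
  moreover have "eval_word G (map (\<lambda>(i, e). (if i then x else y, e)) w) = \<one>"
  proof -
    have "eval_word G (map (\<lambda>(i, e). (if i then x else y, e)) w) =
        x [^] i \<otimes> (y [^] j \<otimes> (inv (x [^] i) \<otimes> inv (y [^] j)))"
      using xy by (simp add: w_def eval_word_append eval_word_replicate nat_pow_inv ij set_replicate_conv_if)
    also have "inv (x [^] i) \<otimes> inv (y [^] j) = inv (x [^] i \<otimes> y [^] j)"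
      unfolding com using xy by (simp add: inv_mult_group)
    also have "x [^] i \<otimes> (y [^] j \<otimes> inv (x [^] i \<otimes> y [^] j)) = \<one>"
      using xy by (simp add: m_assoc[symmetric])
    finally show ?thesis .
  qed
  ultimately show False using ne by blast
qed

context hyp_group
begin

text \<open>If no g works, every g intertwines powers of b, so \<open>g\<^sup>2\<close> has a power
  in the cyclic group of b. For the free generators x and y this makes powers of x and y commute.
  The points \<open>g \<otimes> v [^] m\<close> stand for powers of a conjugate of b, from which
  they are |g| away.\<close>

lemma independent_conjugate:
  assumes b: "lox b" and ne: "non_elementary G"
  obtains g k where "g \<in> carrier G"
    "\<And>u v (n::nat) (m::nat). u \<in> {b, inv b} \<Longrightarrow> v \<in> {b, inv b} \<Longrightarrow> gp \<one> (u [^] n) (g \<otimes> v [^] m) \<le> k"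
proof (rule ccontr)
  note witness = that
  assume neg: "\<not> thesis"
  have bc: "b \<in> carrier G" using b lox_carrier by blast
  obtain x y where xy: "x \<in> carrier G" "y \<in> carrier G" and free: "\<And>w :: (bool \<times> bool) list.
      w \<noteq> [] \<Longrightarrow> freely_reduced w \<Longrightarrow> eval_word G (map (\<lambda>(i, e). (if i then x else y, e)) w) \<noteq> \<one>"
    using ne unfolding non_elementary_def by blast
  have "\<exists>e::nat. 0 < e \<and> (g \<otimes> g) \<otimes> b [^] e = b [^] e \<otimes> (g \<otimes> g)" if g: "g \<in> carrier G" for g
  proof -
    have "\<exists>u\<in>{b, inv b}. \<exists>v\<in>{b, inv b}. \<exists>(n::nat) (m::nat). gp \<one> (u [^] n) (g \<otimes> v [^] m) > M" for M
      using neg witness[OF g, of M] by (meson not_le)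
    then obtain e :: nat and q :: int where "0 < e" "g \<otimes> b [^] e = b [^] q \<otimes> g"
      using unbounded_gp_imp_intertwine[OF b g] by blast
    then show ?thesis using intertwine_imp_commute_square[OF b g] by blast
  qed
  then have *: "\<exists>i::nat. 0 < i \<and> (\<exists>q::int. (g \<otimes> g) [^] i = b [^] q)" if "g \<in> carrier G" for g
    using commute_pow_imp_common_power[OF b _ m_closed[OF that that]] that by meson
  obtain i j :: nat and q q' :: int where ij: "0 < i" "0 < j"
    and q: "(x \<otimes> x) [^] i = b [^] q" "(y \<otimes> y) [^] j = b [^] q'"
    using *[OF xy(1)] *[OF xy(2)] by blast
  have "(g \<otimes> g) [^] n = g [^] (2 * n)" if "g \<in> carrier G" for g and n :: nat
    using nat_pow_pow[OF that, of 2 n] that by (simp add: numeral_2_eq_2)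
  then have "x [^] (2 * i) \<otimes> y [^] (2 * j) = y [^] (2 * j) \<otimes> x [^] (2 * i)"
    using q xy int_pow_mult[OF bc, of q q'] int_pow_mult[OF bc, of q' q] by (simp add: add.commute)
  then show False using not_commuting_powers[OF free xy, of "2 * i" "2 * j"] ij by simp
qed

end

section \<open>Products of large translation length in a normal subgroup\<close>

context hyp_group
begin

text \<open>The ends of \<open>f\<^sub>1\<close> and \<open>f\<^sub>2\<close> diverge within k +
  |g|, so no h can follow an end of each beyond \<kappa>; hence one of the two is transverse to h at
  both its ends. The exponent n makes both elements long compared with \<kappa> and
  \<delta>.\<close>

lemma transverse_elements:
  assumes b: "lox b" and ne: "non_elementary G"
  obtains f\<^sub>1 f\<^sub>2 g \<kappa> and n :: nat where
    "g \<in> carrier G" "f\<^sub>1 = b [^] n" "f\<^sub>2 = g \<otimes> b [^] n \<otimes> inv g"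
    "4 * \<kappa> + 4 * \<delta> < N f\<^sub>1" "4 * \<kappa> + 4 * \<delta> < N f\<^sub>2" "0 \<le> \<kappa>"
    "\<And>h. h \<in> carrier G \<Longrightarrow> \<exists>f\<in>{f\<^sub>1, f\<^sub>2}. gp \<one> h f \<le> \<kappa> \<and> gp \<one> h (inv f) \<le> \<kappa>"
proof -
  have bc: "b \<in> carrier G" using b lox_carrier by blast
  obtain g k where g: "g \<in> carrier G"
    and k: "\<And>u v (n::nat) (m::nat). u \<in> {b, inv b} \<Longrightarrow> v \<in> {b, inv b} \<Longrightarrow> gp \<one> (u [^] n) (g \<otimes> v [^] m) \<le> k"
    using independent_conjugate[OF b ne] by blast
  obtain t where t: "0 < t" "\<And>n::nat. real (N (b [^] n)) \<ge> real n * t"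
    using lox_growth_pos[OF b] by blast
  define \<kappa> where "\<kappa> = k + N g + \<delta>"
  have "0 \<le> k"
    using k[of b b 0 0] gp_nonneg[of \<one> "b [^] (0::nat)" "g \<otimes> b [^] (0::nat)"] g bc by fastforce
  then have \<kappa>: "0 \<le> \<kappa>" using delta_nonneg by (simp add: \<kappa>_def)
  obtain n :: nat where n: "real n * t > 4 * \<kappa> + 4 * \<delta> + 2 * N g" using reals_Archimedean3[OF t(1)] by blast
  then have nb: "real (N (b [^] n)) > 4 * \<kappa> + 4 * \<delta> + 2 * N g" using t(2)[of n] by linarith
  define f1 f2 where "f1 = b [^] n" and "f2 = g \<otimes> b [^] n \<otimes> inv g"
  have c: "f1 \<in> carrier G" "f2 \<in> carrier G" using bc g by (simp_all add: f1_def f2_def)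
  have "b [^] n = inv g \<otimes> (f2 \<otimes> g)" using bc g by (simp add: f2_def m_assoc)
  then have "N (b [^] n) \<le> N g + (N f2 + N g)"
    using N_mult[of "inv g" "f2 \<otimes> g"] N_mult[of f2 g] c g by simp
  then have big: "4 * \<kappa> + 4 * \<delta> < N f1" "4 * \<kappa> + 4 * \<delta> < N f2" using nb by (simp_all add: f1_def)
  have indep: "gp \<one> s (g \<otimes> v [^] n \<otimes> inv g) \<le> k + N g" if "s \<in> {f1, inv f1}" "v \<in> {b, inv b}" for s v
  proof -
    have "s = b [^] n \<or> s = inv b [^] n" using that(1) bc by (auto simp: f1_def nat_pow_inv)
    then obtain u where u: "u \<in> {b, inv b}" "s = u [^] n" by blast
    have uv: "u \<in> carrier G" "v \<in> carrier G" using u that bc by auto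
    have "d (g \<otimes> v [^] n \<otimes> inv g) (g \<otimes> v [^] n) = N g"
      using d_right_mult[of "g \<otimes> v [^] n" "inv g"] d_commute[of "g \<otimes> v [^] n \<otimes> inv g" "g \<otimes> v [^] n"] uv g by simp
    then show ?thesis
      using gp_move[of \<one> "u [^] n" "g \<otimes> v [^] n \<otimes> inv g" "g \<otimes> v [^] n"] k[OF u(1) that(2), of n n] uv g u(2)
      by simp
  qed
  have indep': "gp \<one> s\<^sub>1 s\<^sub>2 \<le> k + N g" if "s\<^sub>1 \<in> {f1, inv f1}" "s\<^sub>2 \<in> {f2, inv f2}" for s\<^sub>1 s\<^sub>2
  proof -
    have "inv f2 = g \<otimes> inv b [^] n \<otimes> inv g"
      using bc g by (simp add: f2_def inv_mult_group nat_pow_inv m_assoc)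
    then have "s\<^sub>2 = g \<otimes> b [^] n \<otimes> inv g \<or> s\<^sub>2 = g \<otimes> inv b [^] n \<otimes> inv g"
      using that(2) by (auto simp: f2_def)
    then show ?thesis using indep[OF that(1), of b] indep[OF that(1), of "inv b"] by auto
  qed
  have "\<exists>f\<in>{f1, f2}. gp \<one> h f \<le> \<kappa> \<and> gp \<one> h (inv f) \<le> \<kappa>" if h: "h \<in> carrier G" for h
  proof (rule ccontr)
    assume "\<not> ?thesis"
    then obtain s\<^sub>1 s\<^sub>2 where s: "s\<^sub>1 \<in> {f1, inv f1}" "\<kappa> < gp \<one> h s\<^sub>1" "s\<^sub>2 \<in> {f2, inv f2}" "\<kappa> < gp \<one> h s\<^sub>2"
      by force
    have sc: "s\<^sub>1 \<in> carrier G" "s\<^sub>2 \<in> carrier G" using s c by auto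
    define m where "m = min (gp \<one> h s\<^sub>1) (gp \<one> h s\<^sub>2)"
    have "m - \<delta> \<le> gp \<one> s\<^sub>1 s\<^sub>2"
      using sc h gp_sym[of s\<^sub>1 h \<one>] by (intro hyp_ge[of \<one> s\<^sub>1 h s\<^sub>2]) (auto simp: m_def)
    moreover have "m > \<kappa>" using s by (simp add: m_def)
    ultimately show False using indep'[OF s(1,3)] by (simp add: \<kappa>_def)
  qed
  then show ?thesis using that[OF g f1_def f2_def big \<kappa>] by blast
qed

text \<open>The periodic path with steps h, f, h^(-1), f' has its corners controlled by the four
  assumed products, so it never turns back. The corners of one period lose 8\<kappa> + 8\<delta> in
  total, which |f| and |f'| repay, and 2|h| is left.\<close>

lemma displacement_of_transverse_product:
  assumes c: "h \<in> carrier G" "f \<in> carrier G" "f' \<in> carrier G" "x \<in> carrier G"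
    and h: "N h > 2 * \<kappa> + 2 * \<delta>" and f: "N f > 4 * \<kappa> + 4 * \<delta>" "N f' > 4 * \<kappa> + 4 * \<delta>" and \<kappa>: "0 \<le> \<kappa>"
    and gp: "gp \<one> (inv h) f \<le> \<kappa>" "gp \<one> (inv h) (inv f) \<le> \<kappa>" "gp \<one> h f' \<le> \<kappa>" "gp \<one> h (inv f') \<le> \<kappa>"
  shows "d x (h \<otimes> f \<otimes> inv h \<otimes> f' \<otimes> x) \<ge> 2 * N h"
proof -
  define \<gamma> where "\<gamma> = h \<otimes> f \<otimes> inv h \<otimes> f'"
  have \<gamma>: "\<gamma> \<in> carrier G" using c by (simp add: \<gamma>_def)
  \<comment> \<open>\<open>q\<close> lists the vertices of one period, \<open>u\<close> the labels
    of its steps, and \<open>p\<close> continues the path by translating with powers of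
    \<gamma>.\<close>
  define q where "q r = (if r = 0 then \<one> else if r = 1 then h else if r = 2 then h \<otimes> f else h \<otimes> f \<otimes> inv h)"
    for r :: nat
  define u where "u r = (if r = 0 then h else if r = 1 then f else if r = 2 then inv h else f')" for r :: nat
  define p where "p n = \<gamma> [^] (n div 4) \<otimes> q (n mod 4)" for n :: nat
  have qc: "q r \<in> carrier G" and uc: "u r \<in> carrier G" for r using c by (simp_all add: q_def u_def)
  have pc: "p n \<in> carrier G" for n using qc \<gamma> by (simp add: p_def)
  have pS: "p (Suc n) = p n \<otimes> u (n mod 4)" for n
  proof -
    have "n mod 4 < 4" by simp
    then consider "n mod 4 = 0" | "n mod 4 = 1" | "n mod 4 = 2" | "n mod 4 = 3" by linarith
    then show ?thesis
    proof cases
      case 4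
      then have "Suc n mod 4 = 0" "Suc n div 4 = Suc (n div 4)" by presburger+
      then show ?thesis using c \<gamma> 4 by (simp add: p_def q_def u_def m_assoc) (simp add: \<gamma>_def m_assoc)
    next
      case 1
      then have "Suc n mod 4 = 1" "Suc n div 4 = n div 4" by presburger+
      then show ?thesis using c \<gamma> 1 by (simp add: p_def q_def u_def m_assoc)
    next
      case 2
      then have "Suc n mod 4 = 2" "Suc n div 4 = n div 4" by presburger+
      then show ?thesis using c \<gamma> 2 by (simp add: p_def q_def u_def m_assoc)
    next
      case 3
      then have "Suc n mod 4 = 3" "Suc n div 4 = n div 4" by presburger+
      then show ?thesis using c \<gamma> 3 by (simp add: p_def q_def u_def m_assoc)
    qed
  qed
  have dp: "d (p n) (p (Suc n)) = N (u (n mod 4))" for n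
    unfolding pS using d_right_mult[OF pc uc] by simp
  have Nu: "N (u r) > 2 * \<kappa> + 2 * \<delta>" for r
    using h f c \<kappa> delta_nonneg by (auto simp: u_def)
  have turn: "gp (p (Suc n)) (p n) (p (Suc (Suc n))) \<le> \<kappa>" for n
  proof -
    let ?v = "u (n mod 4)" and ?w = "u (Suc n mod 4)"
    have "p n = p (Suc n) \<otimes> inv ?v" unfolding pS using pc uc by (simp add: m_assoc)
    then have "gp (p (Suc n)) (p n) (p (Suc (Suc n))) = gp \<one> (inv ?v) ?w"
      using gp_left_mult[of "p (Suc n)" \<one> "inv ?v" ?w] pc uc by (simp add: pS[of "Suc n"])
    also have "\<dots> \<le> \<kappa>"
    proof -
      \<comment> \<open>The corners are the four assumed products, two of them with swapped
        arguments; the last corner is where one period meets the next.\<close>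
      have "(n mod 4 = 0 \<and> Suc n mod 4 = 1) \<or> (n mod 4 = 1 \<and> Suc n mod 4 = 2) \<or>
        (n mod 4 = 2 \<and> Suc n mod 4 = 3) \<or> (n mod 4 = 3 \<and> Suc n mod 4 = 0)" by presburger
      then show ?thesis
        using gp gp_sym[of "inv f" "inv h" \<one>] gp_sym[of "inv f'" h \<one>] c
        by (elim disjE conjE) (simp_all add: u_def)
    qed
    finally show ?thesis .
  qed
  have step: "N (p (Suc n)) \<ge> N (p n) + N (u (n mod 4)) - 2 * \<kappa> - 2 * \<delta>" for n
    using local_to_global_dist[of p \<kappa> n] pc turn Nu unfolding dp by (simp add: p_def q_def)
  have p4: "p (4 * n) = \<gamma> [^] n" for n using \<gamma> by (simp add: p_def q_def)
  have period: "real (N (\<gamma> [^] Suc n)) \<ge> real (N (\<gamma> [^] n)) + 2 * real (N h)" for n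
  proof -
    have "Suc (4 * n) mod 4 = 1" "Suc (Suc (4 * n)) mod 4 = 2" "Suc (Suc (Suc (4 * n))) mod 4 = 3"
      and 4: "4 * Suc n = Suc (Suc (Suc (Suc (4 * n))))" by presburger+
    then have "real (N (p (4 * Suc n))) \<ge> N (p (4 * n)) + 2 * N h + N f + N f' - 8 * \<kappa> - 8 * \<delta>"
      using step[of "4 * n"] step[of "Suc (4 * n)"] step[of "Suc (Suc (4 * n))"]
        step[of "Suc (Suc (Suc (4 * n)))"] c unfolding 4 by (simp add: u_def)
    then show ?thesis using f unfolding p4 by simp
  qed
  have growth: "real (N (\<gamma> [^] n)) \<ge> real n * (2 * real (N h))" for n
  proof (induction n)
    case (Suc n)
    then show ?case using period[of n] by (simp add: algebra_simps del: nat_pow_Suc)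
  qed simp
  have "real n * (2 * real (N h)) \<le> real n * d x (\<gamma> \<otimes> x) + 2 * real (N x)" for n
    by (rule order_trans[OF growth N_pow_le_displacement[OF \<gamma> c(4)]])
  then have "2 * real (N h) \<le> d x (\<gamma> \<otimes> x)" by (rule archimedean_le)
  then show ?thesis by (simp add: \<gamma>_def)
qed

theorem normal_subgroup_displacement:
  assumes b: "lox b" "b \<in> A" and ne: "non_elementary G"
    and A: "subgroup A G" "\<forall>g\<in>carrier G. \<forall>a\<in>A. g \<otimes> a \<otimes> inv g \<in> A"
  obtains F and C :: real where "finite F" "F \<subseteq> A"
    "\<And>h. h \<in> carrier G \<Longrightarrow> \<exists>f\<in>F. \<exists>f'\<in>F. \<forall>x\<in>carrier G. d x (h \<otimes> f \<otimes> inv h \<otimes> f' \<otimes> x) \<ge> 2 * N h - C"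
proof -
  obtain f\<^sub>1 f\<^sub>2 g \<kappa> and n :: nat where g: "g \<in> carrier G" "f\<^sub>1 = b [^] n" "f\<^sub>2 = g \<otimes> b [^] n \<otimes> inv g"
    and big: "4 * \<kappa> + 4 * \<delta> < N f\<^sub>1" "4 * \<kappa> + 4 * \<delta> < N f\<^sub>2" and \<kappa>: "0 \<le> \<kappa>"
    and tr: "\<And>h. h \<in> carrier G \<Longrightarrow> \<exists>f\<in>{f\<^sub>1, f\<^sub>2}. gp \<one> h f \<le> \<kappa> \<and> gp \<one> h (inv f) \<le> \<kappa>"
    using transverse_elements[OF b(1) ne] by metis
  have bn: "b [^] n \<in> A"
    by (induction n) (use A(1) b(2) in \<open>auto simp: subgroup.one_closed subgroup.m_closed\<close>)
  have FA: "{f\<^sub>1, f\<^sub>2} \<subseteq> A" using bn bspec[OF bspec[OF A(2) g(1)] bn] g by simp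
  have main: "\<exists>f\<in>{f\<^sub>1, f\<^sub>2}. \<exists>f'\<in>{f\<^sub>1, f\<^sub>2}. \<forall>x\<in>carrier G.
      d x (h \<otimes> f \<otimes> inv h \<otimes> f' \<otimes> x) \<ge> 2 * N h - (4 * \<kappa> + 4 * \<delta>)" if h: "h \<in> carrier G" for h
  proof -
    \<comment> \<open>In the periodic path f stands between h and its inverse, so both its ends must
      be transverse to \<open>inv h\<close>; f' stands between \<open>inv h\<close> and the next h,
      so its ends must be transverse to h.\<close>
    obtain f where f: "f \<in> {f\<^sub>1, f\<^sub>2}" "gp \<one> (inv h) f \<le> \<kappa>" "gp \<one> (inv h) (inv f) \<le> \<kappa>" using tr[of "inv h"] h by blast
    obtain f' where f': "f' \<in> {f\<^sub>1, f\<^sub>2}" "gp \<one> h f' \<le> \<kappa>" "gp \<one> h (inv f') \<le> \<kappa>" using tr[of h] h by blast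
    have c: "f \<in> carrier G" "f' \<in> carrier G" using f(1) f'(1) FA subgroup.subset[OF A(1)] by auto
    have "d x (h \<otimes> f \<otimes> inv h \<otimes> f' \<otimes> x) \<ge> 2 * N h - (4 * \<kappa> + 4 * \<delta>)" if x: "x \<in> carrier G" for x
    \<comment> \<open>For shorter h the constant 4\<kappa> + 4\<delta> makes the lower bound at most
      0.\<close>
    proof (cases "N h > 2 * \<kappa> + 2 * \<delta>")
      case True
      have "N f > 4 * \<kappa> + 4 * \<delta>" "N f' > 4 * \<kappa> + 4 * \<delta>" using big f(1) f'(1) by auto
      then have "d x (h \<otimes> f \<otimes> inv h \<otimes> f' \<otimes> x) \<ge> 2 * N h"
        using displacement_of_transverse_product[OF h c x True] \<kappa> f f' by blast
      then show ?thesis using \<kappa> delta_nonneg by simp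
    next
      case False
      then show ?thesis using d_nonneg[of x "h \<otimes> f \<otimes> inv h \<otimes> f' \<otimes> x"] by linarith
    qed
    then show ?thesis using f f' by blast
  qed
  show ?thesis by (rule that[OF _ FA main]) simp_all
qed

end

section \<open>Axes of loxodromic elements\<close>

text \<open>Compactness of a countable product of finite sets, by the diagonal argument; it serves
  as Arzela-Ascoli for paths of vertices.\<close>

lemma pointwise_constant_subsequence:
  fixes F :: "nat \<Rightarrow> 'i::countable \<Rightarrow> 'b"
  assumes fin: "\<And>t. finite (range (\<lambda>n. F n t))"
  obtains r g where "strict_mono (r :: nat \<Rightarrow> nat)" "\<And>t. \<forall>\<^sub>F k in sequentially. F (r k) t = g t"
proof -
  define P where "P m s = (\<exists>v. \<forall>k. F (s k) (from_nat m) = v)" for m :: nat and s :: "nat \<Rightarrow> nat"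
  interpret subseqs P
  proof
    fix m :: nat and s :: "nat \<Rightarrow> nat"
    assume "strict_mono s"
    let ?t = "from_nat m :: 'i"
    have "finite ((\<lambda>k. F (s k) ?t) ` UNIV)" by (rule finite_subset[OF _ fin[of ?t]]) auto
    then obtain k\<^sub>0 where inf: "infinite {k \<in> UNIV. F (s k) ?t = F (s k\<^sub>0) ?t}"
      using pigeonhole_infinite[OF infinite_UNIV_nat] by blast
    let ?r = "enumerate {k \<in> UNIV. F (s k) ?t = F (s k\<^sub>0) ?t}"
    have "strict_mono ?r" using inf strict_mono_enumerate by blast
    moreover have "F (s (?r k)) ?t = F (s k\<^sub>0) ?t" for k using enumerate_in_set[OF inf, of k] by simp
    ultimately show "\<exists>r'. strict_mono r' \<and> P m (s \<circ> r')" unfolding P_def comp_def by blast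
  qed
  have P: "P m (diagseq \<circ> (+) (Suc m))" for m
    by (rule diagseq_holds) (auto simp: P_def)
  have "\<exists>v. \<forall>k. F (diagseq (Suc (to_nat t) + k)) t = v" for t
  proof -
    obtain v where "\<forall>k. F ((diagseq \<circ> (+) (Suc (to_nat t))) k) (from_nat (to_nat t)) = v"
      using P[of "to_nat t"] unfolding P_def ..
    then show ?thesis by (auto simp: from_nat_to_nat)
  qed
  then obtain g where g: "\<And>t k. F (diagseq (Suc (to_nat t) + k)) t = g t" by metis
  have "\<forall>\<^sub>F k in sequentially. F (diagseq k) t = g t" for t
    unfolding eventually_sequentially
  proof (intro exI allI impI)
    fix k assume "Suc (to_nat t) \<le> k"
    then show "F (diagseq k) t = g t" using g[of t "k - Suc (to_nat t)"] by simp
  qed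
  then show ?thesis using that subseq_diagseq by blast
qed

context hyp_group
begin

text \<open>For y on a geodesic from z to e the product based at z is \<open>d z y\<close>, and
  moving the base to \<open>\<one>\<close> costs at most R.\<close>

lemma gp_on_geodesic:
  assumes "z \<in> carrier G" "y \<in> carrier G" "e \<in> carrier G" "d z e = d z y + d y e" "d z \<one> \<le> R"
  shows "gp \<one> y e \<ge> d z y - R"
  using assms d_triangle[of z \<one> y] d_triangle[of z \<one> e] by (simp add: gromov_prod_def field_simps)

text \<open>Near-additivity bounds the product of the two endpoints at \<open>a [^] m\<close>, so
  \<open>close_of_between\<close> puts \<open>a [^] m\<close> within R of the geodesic joining them.
  Time 0 is set at the point near \<open>\<one>\<close>, so that segments for different n can be
  compared.\<close>

lemma lox_segment:
  fixes n :: nat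
  assumes a: "a \<in> carrier G" and k: "0 \<le> k"
    "\<And>m n::nat. real (N (a [^] m)) + real (N (a [^] n)) \<le> real (N (a [^] (m + n))) + 2 * k"
  defines "R \<equiv> 4 * k + 2 * \<delta>"
  obtains f :: "int \<Rightarrow> 'a" and p q :: int where
    "0 \<le> p" "0 \<le> q" "real (N (a [^] n)) - R \<le> p" "real (N (a [^] n)) - R \<le> q"
    "\<And>t. f t \<in> carrier G" "f (- p) = inv (a [^] n)" "f q = a [^] n"
    "\<And>s t. - p \<le> s \<Longrightarrow> s \<le> q \<Longrightarrow> - p \<le> t \<Longrightarrow> t \<le> q \<Longrightarrow> d (f s) (f t) = real_of_int \<bar>s - t\<bar>"
    "\<And>t. d (f 0) (f t) \<le> real_of_int \<bar>t\<bar>" "d (f 0) \<one> \<le> R"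
    "\<And>m. m \<le> n \<Longrightarrow> \<exists>t. - p \<le> t \<and> t \<le> q \<and> d (f t) (a [^] m) \<le> R"
proof -
  let ?x = "inv (a [^] n)" and ?y = "a [^] n"
  have xy: "?x \<in> carrier G" "?y \<in> carrier G" using a by auto
  obtain h :: "nat \<Rightarrow> 'a" and L where h: "\<And>i. h i \<in> carrier G" "h 0 = ?x" "h L = ?y" "d ?x ?y = L"
    "\<And>i j. i \<le> j \<Longrightarrow> j \<le> L \<Longrightarrow> d (h i) (h j) = real j - real i"
    using discrete_geodesic[OF xy] by blast
  have dx: "d ?x (a [^] m) = N (a [^] (n + m))" for m :: nat
    using a by (simp add: word_dist_def nat_pow_mult)
  have L: "real L = N (a [^] (n + n))" using h(4) dx[of n] by simp
  \<comment> \<open>The time at which the geodesic is as far from its left end as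
    \<open>a [^] m\<close>, cut off at L because that distance may exceed L by up to 2k.\<close>
  define i where "i m = min L (N (a [^] (n + m)))" for m :: nat
  have iL: "i m \<le> L" for m by (simp add: i_def)
  have im: "\<bar>real (i m) - N (a [^] (n + m))\<bar> \<le> 2 * k" and hm: "d (h (i m)) (a [^] m) \<le> R" if m: "m \<le> n" for m
  proof -
    have 1: "real (N (a [^] (n + m))) + real (N (a [^] (n - m))) \<le> real L + 2 * k"
      using k(2)[of "n + m" "n - m"] m L by simp
    then show 2: "\<bar>real (i m) - N (a [^] (n + m))\<bar> \<le> 2 * k" using k(1) by (simp add: i_def min_def)
    have dxi: "d ?x (h (i m)) = i m" using h(5)[of 0 "i m"] iL h(2) by simp
    have dyi: "d (h (i m)) ?y = real L - i m" using h(5)[of "i m" L] iL h(3) by simp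
    have "d ?y (a [^] m) = N (a [^] (n - m))" using d_pow[OF a m] d_commute[of ?y "a [^] m"] a by simp
    then have "gp (a [^] m) ?x ?y \<le> k" using 1 dx[of m] h(4) a by (simp add: gromov_prod_def)
    moreover have "gp (h (i m)) ?x ?y \<le> k"
      using dxi dyi h(1,4) k(1) xy d_commute[of ?y "h (i m)"] by (simp add: gromov_prod_def)
    ultimately have "d (h (i m)) (a [^] m) \<le> 2 * k + 2 * k + 2 * \<delta>"
      using 2 dxi dx[of m] h(1) xy a by (intro close_of_between[of ?x _ _ ?y]) auto
    then show "d (h (i m)) (a [^] m) \<le> R" by (simp add: R_def)
  qed
  define p q where "p = int (i 0)" and "q = int L - int (i 0)"
  have pq: "0 \<le> p" "0 \<le> q" using iL[of 0] by (simp_all add: p_def q_def)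
  \<comment> \<open>Clamping the time makes f constant beyond the ends, so the bound on
    \<open>d (f 0) (f t)\<close> holds for all integers t, as the limit argument requires.\<close>
  define f where "f t = h (nat (min q (max (- p) t) + p))" for t
  have fc: "f t \<in> carrier G" for t using h(1) by (simp add: f_def)
  have f_in: "f t = h (nat (t + p))" if "- p \<le> t" "t \<le> q" for t using that by (simp add: f_def)
  have f0: "f 0 = h (i 0)" using f_in[of 0] pq by (simp add: p_def)
  have iso: "d (f s) (f t) = real_of_int \<bar>s - t\<bar>" if "- p \<le> s" "s \<le> q" "- p \<le> t" "t \<le> q" for s t
  proof -
    have *: "d (f s) (f t) = real_of_int \<bar>s - t\<bar>" if "- p \<le> s" "s \<le> t" "t \<le> q" for s t
      using h(5)[of "nat (s + p)" "nat (t + p)"] f_in[of s] f_in[of t] that pq iL[of 0]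
      by (simp add: nat_le_iff q_def p_def)
    show ?thesis using *[of s t] *[of t s] that d_commute[OF fc fc, of s t] by (cases "s \<le> t") auto
  qed
  have 0: "d (f 0) \<one> \<le> R" using hm[of 0] f0 by simp
  have ends: "f (- p) = ?x" "f q = ?y" using f_in[of "- p"] f_in[of q] pq h(2,3) by (simp_all add: p_def q_def)
  have lip: "d (f 0) (f t) \<le> real_of_int \<bar>t\<bar>" for t
  proof -
    let ?c = "min q (max (- p) t)"
    have "f t = f ?c" using pq by (simp add: f_def)
    then have "d (f 0) (f t) = real_of_int \<bar>?c\<bar>" using iso[of 0 ?c] pq by simp
    also have "\<dots> \<le> real_of_int \<bar>t\<bar>" using pq by simp
    finally show ?thesis .
  qed
  have Np: "real (N (a [^] n)) - R \<le> p"
  proof -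
    have "d (f 0) (f (- p)) = p" using iso[of 0 "- p"] pq by simp
    moreover have "d \<one> ?x \<le> d \<one> (f 0) + d (f 0) ?x" using fc xy d_triangle[of \<one> "f 0" ?x] by simp
    ultimately show ?thesis using 0 ends fc a d_commute[of \<one> "f 0"] by simp
  qed
  have Nq: "real (N (a [^] n)) - R \<le> q"
  proof -
    have "d (f 0) (f q) = q" using iso[of 0 q] pq by simp
    moreover have "d \<one> ?y \<le> d \<one> (f 0) + d (f 0) ?y" using fc xy d_triangle[of \<one> "f 0" ?y] by simp
    ultimately show ?thesis using 0 ends fc a d_commute[of \<one> "f 0"] by simp
  qed
  have near: "\<exists>t. - p \<le> t \<and> t \<le> q \<and> d (f t) (a [^] m) \<le> R" if "m \<le> n" for m
    using hm[OF that] f_in[of "int (i m) - p"] iL[of m] pq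
    by (intro exI[of _ "int (i m) - p"]) (simp add: p_def q_def)
  show ?thesis by (rule that[OF pq Np Nq fc ends iso lip 0 near])
qed

text \<open>A limit of the segments of \<open>lox_segment\<close>. The last two conclusions are
  convergence to the ends of a in quantitative form: a point of the axis and a power both lie on the
  way to one far power, so they share their way up to the nearer of them.\<close>

theorem lox_axis:
  assumes "lox a"
  obtains \<gamma> :: "int \<Rightarrow> 'a" and R :: real where
    "\<And>t. \<gamma> t \<in> carrier G" "\<And>s t. d (\<gamma> s) (\<gamma> t) = real_of_int \<bar>s - t\<bar>"
    "\<And>m::nat. \<exists>t. d (\<gamma> t) (a [^] m) \<le> R"
    "\<And>t (m::nat). 0 \<le> t \<Longrightarrow> gp \<one> (\<gamma> t) (a [^] m) \<ge> min (real_of_int t) (real (N (a [^] m))) - R"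
    "\<And>t (m::nat). 0 \<le> t \<Longrightarrow> gp \<one> (\<gamma> (- t)) (inv a [^] m) \<ge> min (real_of_int t) (real (N (a [^] m))) - R"
proof -
  have a: "a \<in> carrier G" using assms lox_carrier by blast
  obtain k where k: "0 \<le> k"
    "\<And>m n::nat. real (N (a [^] m)) + real (N (a [^] n)) \<le> real (N (a [^] (m + n))) + 2 * k"
    using lox_additive[OF assms] by blast
  obtain e where e: "0 < e" "\<And>n::nat. real (N (a [^] n)) \<ge> real n * e"
    using lox_growth_pos[OF assms] by blast
  define R where "R = 4 * k + 2 * \<delta>"
  \<comment> \<open>Packed into one predicate so that f, p and q can be chosen for all n
    simultaneously.\<close>
  define good where "good n f p q \<longleftrightarrow> 0 \<le> p \<and> 0 \<le> q \<and> real (N (a [^] n)) - R \<le> p \<and> real (N (a [^] n)) - R \<le> q \<and>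
    (\<forall>t. f t \<in> carrier G) \<and> f (- p) = inv (a [^] n) \<and> f q = a [^] n \<and>
    (\<forall>s t. - p \<le> s \<longrightarrow> s \<le> q \<longrightarrow> - p \<le> t \<longrightarrow> t \<le> q \<longrightarrow> d (f s) (f t) = real_of_int \<bar>s - t\<bar>) \<and>
    (\<forall>t. d (f 0) (f t) \<le> real_of_int \<bar>t\<bar>) \<and> d (f 0) \<one> \<le> R \<and>
    (\<forall>m\<le>n. \<exists>t. - p \<le> t \<and> t \<le> q \<and> d (f t) (a [^] m) \<le> R)"
    for n :: nat and f :: "int \<Rightarrow> 'a" and p q :: int
  have "\<exists>f p q. good n f p q" for n
  proof (rule lox_segment[OF a k, of n, folded R_def], goal_cases)
    case (1 f p q)
    then have "good n f p q" unfolding good_def by blast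
    then show ?case by blast
  qed
  then obtain f p q where good: "\<And>n. good n (f n) (p n) (q n)" by metis
  have pq: "0 \<le> p n" "0 \<le> q n" "real (N (a [^] n)) - R \<le> p n" "real (N (a [^] n)) - R \<le> q n"
    and fc: "f n t \<in> carrier G" and ends: "f n (- p n) = inv (a [^] n)" "f n (q n) = a [^] n"
    and lip: "d (f n 0) (f n t) \<le> real_of_int \<bar>t\<bar>" and 0: "d (f n 0) \<one> \<le> R"
    for n t using good[of n] unfolding good_def by auto
  have iso: "- p n \<le> s \<Longrightarrow> s \<le> q n \<Longrightarrow> - p n \<le> t \<Longrightarrow> t \<le> q n \<Longrightarrow> d (f n s) (f n t) = real_of_int \<bar>s - t\<bar>"
    for n s t using good[of n] unfolding good_def by blast
  have near: "m \<le> n \<Longrightarrow> \<exists>t. - p n \<le> t \<and> t \<le> q n \<and> d (f n t) (a [^] m) \<le> R"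
    for m n using good[of n] unfolding good_def by blast
  have "finite (range (\<lambda>n. f n t))" for t
  proof (rule finite_subset[OF _ finite_ball[of "R + real_of_int \<bar>t\<bar>"]])
    have "d \<one> (f n t) \<le> R + real_of_int \<bar>t\<bar>" for n
      using 0[of n] lip[of n t] d_triangle[of \<one> "f n 0" "f n t"] d_commute[of \<one> "f n 0"] fc by simp
    then show "range (\<lambda>n. f n t) \<subseteq> {g \<in> carrier G. real (N g) \<le> R + real_of_int \<bar>t\<bar>}" using fc by auto
  qed
  then obtain r \<gamma> where r: "strict_mono r" and lim: "\<And>t. \<forall>\<^sub>F j in sequentially. f (r j) t = \<gamma> t"
    using pointwise_constant_subsequence[of f] by blast
  have big: "\<forall>\<^sub>F j in sequentially. c \<le> p (r j) \<and> c \<le> q (r j) \<and> m \<le> r j" for c :: int and m :: nat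
  proof -
    obtain n :: nat where n: "real n * e > R + c" using reals_Archimedean3[OF e(1)] by blast
    show ?thesis
      unfolding eventually_sequentially
    proof (intro exI allI impI)
      fix j assume j: "max n m \<le> j"
      then have rj: "n \<le> r j" "m \<le> r j" using seq_suble[OF r, of j] by auto
      then have "real n * e \<le> real (r j) * e" using e(1) by (intro mult_right_mono) auto
      then have "R + c < N (a [^] r j)" using e(2)[of "r j"] n by linarith
      then show "c \<le> p (r j) \<and> c \<le> q (r j) \<and> m \<le> r j" using pq(3,4)[of "r j"] rj by linarith
    qed
  qed
  have \<gamma>c: "\<gamma> t \<in> carrier G" for t
  proof -
    obtain j where "f (r j) t = \<gamma> t" using eventually_happens'[OF sequentially_bot lim[of t]] by blast
    then show ?thesis using fc[of "r j" t] by simp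
  qed
  have iso\<gamma>: "d (\<gamma> s) (\<gamma> t) = real_of_int \<bar>s - t\<bar>" for s t
  proof -
    have "\<forall>\<^sub>F j in sequentially. f (r j) s = \<gamma> s \<and> f (r j) t = \<gamma> t \<and>
        (max \<bar>s\<bar> \<bar>t\<bar> \<le> p (r j) \<and> max \<bar>s\<bar> \<bar>t\<bar> \<le> q (r j) \<and> 0 \<le> r j)"
      by (intro eventually_conj lim big)
    then obtain j where j: "f (r j) s = \<gamma> s" "f (r j) t = \<gamma> t" "max \<bar>s\<bar> \<bar>t\<bar> \<le> p (r j)" "max \<bar>s\<bar> \<bar>t\<bar> \<le> q (r j)"
      using eventually_happens'[OF sequentially_bot] by blast
    then show ?thesis using iso[of "r j" s t] by auto
  qed
  have near\<gamma>: "\<exists>t. d (\<gamma> t) (a [^] m) \<le> R" for m :: nat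
  proof -
    \<comment> \<open>The time at which a segment passes \<open>a [^] m\<close> varies with the
      segment, but stays in this fixed window, on which the segments eventually agree with the
      limit.\<close>
    define T where "T = \<lceil>2 * R + N (a [^] m)\<rceil>"
    have "\<forall>\<^sub>F j in sequentially. (\<forall>t\<in>{- T..T}. f (r j) t = \<gamma> t) \<and> (0 \<le> p (r j) \<and> 0 \<le> q (r j) \<and> m \<le> r j)"
      by (intro eventually_conj eventually_ball_finite ballI lim big) simp
    then obtain j where j: "\<And>t. t \<in> {- T..T} \<Longrightarrow> f (r j) t = \<gamma> t" "m \<le> r j"
      using eventually_happens'[OF sequentially_bot] by blast
    obtain t where t: "- p (r j) \<le> t" "t \<le> q (r j)" "d (f (r j) t) (a [^] m) \<le> R" using near[OF j(2)] by blast
    have "real_of_int \<bar>t\<bar> = d (f (r j) 0) (f (r j) t)" using iso[of "r j" 0 t] t pq by simp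
    also have "\<dots> \<le> d (f (r j) 0) \<one> + (d \<one> (a [^] m) + d (a [^] m) (f (r j) t))"
      using d_triangle[of "f (r j) 0" \<one> "f (r j) t"] d_triangle[of \<one> "a [^] m" "f (r j) t"] fc a by simp
    also have "\<dots> \<le> 2 * R + N (a [^] m)"
      using 0[of "r j"] t(3) a d_commute[of "a [^] m" "f (r j) t"] fc by simp
    finally have "t \<in> {- T..T}" unfolding T_def by (simp add: abs_le_iff) linarith
    then show ?thesis using j(1) t(3) by metis
  qed
  define R' where "R' = R + k + \<delta>"
  \<comment> \<open>The sign s treats both ends at once; below, l is the time that the segment takes
    to reach its end on that side.\<close>
  have ray: "gp \<one> (\<gamma> (s * t)) (v [^] m) \<ge> min (real_of_int t) (real (N (a [^] m))) - R'"
    if t: "0 \<le> t" and s: "s = 1 \<and> v = a \<or> s = - 1 \<and> v = inv a" for s t :: int and v and m :: nat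
  proof -
    have v: "v \<in> carrier G" "N (v [^] m) = N (a [^] m)" for m :: nat using s a N_pow_inv[OF a] by auto
    have "\<forall>\<^sub>F j in sequentially. f (r j) (s * t) = \<gamma> (s * t) \<and> (t \<le> p (r j) \<and> t \<le> q (r j) \<and> m \<le> r j)"
      by (intro eventually_conj lim big)
    then obtain j where j: "f (r j) (s * t) = \<gamma> (s * t)" "t \<le> p (r j)" "t \<le> q (r j)" "m \<le> r j"
      using eventually_happens'[OF sequentially_bot] by blast
    define l where "l = (if s = 1 then q (r j) else p (r j))"
    have l: "f (r j) (s * l) = v [^] r j" "t \<le> l" "- p (r j) \<le> s * l" "s * l \<le> q (r j)" "- p (r j) \<le> s * t" "s * t \<le> q (r j)"
      using s ends j pq[of "r j"] t a by (auto simp: l_def nat_pow_inv)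
    have abs: "\<bar>0 - s * l\<bar> = l" "\<bar>0 - s * t\<bar> = t" "\<bar>s * t - s * l\<bar> = l - t" using s t l(2) by auto
    have "d (f (r j) 0) (v [^] r j) = l" "d (f (r j) 0) (\<gamma> (s * t)) = t" "d (\<gamma> (s * t)) (v [^] r j) = l - t"
      using iso[of "r j" 0 "s * l"] iso[of "r j" 0 "s * t"] iso[of "r j" "s * t" "s * l"] l j(1) pq[of "r j"]
      unfolding abs by simp_all
    then have "d (f (r j) 0) (v [^] r j) = d (f (r j) 0) (\<gamma> (s * t)) + d (\<gamma> (s * t)) (v [^] r j)"
      "d (f (r j) 0) (\<gamma> (s * t)) = t" by simp_all
    then have 1: "gp \<one> (\<gamma> (s * t)) (v [^] r j) \<ge> t - R"
      using gp_on_geodesic[of "f (r j) 0" "\<gamma> (s * t)" "v [^] r j" R] fc \<gamma>c v(1) 0 by simp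
    have 2: "gp \<one> (v [^] m) (v [^] r j) \<ge> real (N (a [^] m)) - k"
      using gp_pow[OF v(1) j(4), of k] k(2) v(2) by simp
    have "min (real_of_int t - R) (real (N (a [^] m)) - k) - \<delta> \<le> gp \<one> (\<gamma> (s * t)) (v [^] m)"
      using 1 2 gp_sym[of "v [^] r j" "v [^] m" \<one>] \<gamma>c v(1)
      by (intro hyp_ge[of \<one> "\<gamma> (s * t)" "v [^] r j"]) auto
    moreover have "0 \<le> R" using k(1) delta_nonneg by (simp add: R_def)
    ultimately show ?thesis using k(1) by (simp add: R'_def min_def split: if_splits)
  qed
  have "R \<le> R'" using k(1) delta_nonneg by (simp add: R'_def)
  show ?thesis
  proof (rule that[of \<gamma> R'])
    show "\<exists>t. d (\<gamma> t) (a [^] m) \<le> R'" for m :: nat using near\<gamma>[of m] \<open>R \<le> R'\<close> order_trans by blast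
    show "gp \<one> (\<gamma> t) (a [^] m) \<ge> min (real_of_int t) (real (N (a [^] m))) - R'" if "0 \<le> t" for t and m :: nat
      using ray[OF that, of 1 a m] by simp
    show "gp \<one> (\<gamma> (- t)) (inv a [^] m) \<ge> min (real_of_int t) (real (N (a [^] m))) - R'" if "0 \<le> t" for t and m :: nat
      using ray[OF that, of "- 1" "inv a" m] by simp
  qed (fact \<gamma>c iso\<gamma>)+
qed

end

section \<open>The Cayley graph\<close>

context word_metric
begin

abbreviation cd :: "'a \<times> 'a \<times> real \<Rightarrow> 'a \<times> 'a \<times> real \<Rightarrow> real" where "cd \<equiv> cayley_dist G S"

text \<open>As an image of a finite product the set of candidates is visibly finite, and the rules
  for \<open>Min\<close> apply.\<close>

lemma cayley_dist_eq:
  "cd p q = Min ((\<lambda>((u, a), (v, b)). a + d u v + b) ` (cayley_ends G p \<times> cayley_ends G q) \<union>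
    (if fst p = fst q \<and> fst (snd p) = fst (snd q) then {\<bar>snd (snd p) - snd (snd q)\<bar>} else {}))"
proof -
  have "{a + d u v + b | u a v b. (u, a) \<in> cayley_ends G p \<and> (v, b) \<in> cayley_ends G q} =
      (\<lambda>((u, a), (v, b)). a + d u v + b) ` (cayley_ends G p \<times> cayley_ends G q)"
    (is "?L = ?R")
  proof
    show "?L \<subseteq> ?R"
    proof
      fix x assume "x \<in> ?L"
      then obtain u a v b where "(u, a) \<in> cayley_ends G p" "(v, b) \<in> cayley_ends G q" "x = a + d u v + b"
        by blast
      then show "x \<in> ?R" by (intro image_eqI[of _ _ "((u, a), (v, b))"]) simp_all
    qed
    show "?R \<subseteq> ?L" by auto
  qed
  then show ?thesis by (simp add: cayley_dist_def)
qed

lemma finite_cayley_ends: "finite (cayley_ends G p)"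
  by (simp add: cayley_ends_def split: prod.split)

lemma cayley_pointsE:
  assumes "p \<in> cayley_points G S"
  shows "fst p \<in> carrier G" "\<And>u a. (u, a) \<in> cayley_ends G p \<Longrightarrow> u \<in> carrier G \<and> d (fst p) u \<le> 1 \<and> 0 \<le> a"
    "\<exists>t\<le>1. (fst p, t) \<in> cayley_ends G p"
proof -
  obtain g s t where p: "p = (g, s, t)" by (cases p)
  then have *: "g \<in> carrier G" "s \<in> carrier G" "N s \<le> 1" "0 \<le> t" "t \<le> 1"
    using assms S_carrier N_gen by (auto simp: cayley_points_def)
  then show "fst p \<in> carrier G" "\<And>u a. (u, a) \<in> cayley_ends G p \<Longrightarrow> u \<in> carrier G \<and> d (fst p) u \<le> 1 \<and> 0 \<le> a"
    "\<exists>t\<le>1. (fst p, t) \<in> cayley_ends G p"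
    using p by (auto simp: cayley_ends_def d_right_mult)
qed

text \<open>Replacing a point by the first vertex of its edge costs at most 1 at either end. Through
  this estimate the geometry of the graph is transferred to the group.\<close>

lemma cayley_dist_near_word_dist:
  assumes "p \<in> cayley_points G S" "q \<in> cayley_points G S"
  shows "\<bar>cd p q - d (fst p) (fst q)\<bar> \<le> 2"
proof -
  let ?D = "(\<lambda>((u, a), (v, b)). a + d u v + b) ` (cayley_ends G p \<times> cayley_ends G q) \<union>
    (if fst p = fst q \<and> fst (snd p) = fst (snd q) then {\<bar>snd (snd p) - snd (snd q)\<bar>} else {})"
  note P = cayley_pointsE[OF assms(1)] and Q = cayley_pointsE[OF assms(2)]
  have fin: "finite ?D" using finite_cayley_ends by auto
  obtain t t' where t: "t \<le> 1" "(fst p, t) \<in> cayley_ends G p" "t' \<le> 1" "(fst q, t') \<in> cayley_ends G q"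
    using P(3) Q(3) by blast
  then have "t + d (fst p) (fst q) + t' \<in> ?D" by force
  then have "Min ?D \<le> t + d (fst p) (fst q) + t'" and ne: "?D \<noteq> {}" using fin by (auto intro: Min_le)
  moreover have "x \<ge> d (fst p) (fst q) - 2" if x: "x \<in> ?D" for x
  proof -
    consider u a v b where "(u, a) \<in> cayley_ends G p" "(v, b) \<in> cayley_ends G q" "x = a + d u v + b"
      | "fst p = fst q" "x = \<bar>snd (snd p) - snd (snd q)\<bar>"
      using x by (auto split: if_splits)
    then show ?thesis
    proof cases
      case 1
      note u = P(2)[OF 1(1)] and v = Q(2)[OF 1(2)]
      show ?thesis
        using d_triangle[of "fst p" u "fst q"] d_triangle[of u v "fst q"] d_commute[of v "fst q"] u v P(1) Q(1) 1(3)
        by linarith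
    next
      case 2
      then show ?thesis using Q(1) by simp
    qed
  qed
  then have "d (fst p) (fst q) - 2 \<le> Min ?D" using Min_in[OF fin ne] by blast
  ultimately show ?thesis unfolding cayley_dist_eq using t(1,3) by linarith
qed

lemma cayley_dist_nonneg:
  assumes "p \<in> cayley_points G S" "q \<in> cayley_points G S"
  shows "0 \<le> cd p q"
  unfolding cayley_dist_eq
proof (rule Min.boundedI)
  show "(\<lambda>((u, a), (v, b)). a + d u v + b) ` (cayley_ends G p \<times> cayley_ends G q) \<union>
    (if fst p = fst q \<and> fst (snd p) = fst (snd q) then {\<bar>snd (snd p) - snd (snd q)\<bar>} else {}) \<noteq> {}"
    using cayley_pointsE(3)[OF assms(1)] cayley_pointsE(3)[OF assms(2)] by blast
qed (use finite_cayley_ends cayley_pointsE(2)[OF assms(1)] cayley_pointsE(2)[OF assms(2)] d_nonneg in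
    \<open>auto simp: add_nonneg_nonneg split: if_splits\<close>)

lemma cayley_vertex_point: "g \<in> carrier G \<Longrightarrow> cayley_vertex G g \<in> cayley_points G S"
  by (simp add: cayley_vertex_def cayley_points_def)

lemma cayley_act_point: "a \<in> carrier G \<Longrightarrow> p \<in> cayley_points G S \<Longrightarrow> cayley_act G a p \<in> cayley_points G S"
  by (auto simp: cayley_act_def cayley_points_def split: prod.splits)

lemma fst_cayley_vertex [simp]: "fst (cayley_vertex G g) = g"
  by (simp add: cayley_vertex_def)

lemma fst_cayley_act [simp]: "fst (cayley_act G a p) = a \<otimes> fst p"
  by (simp add: cayley_act_def split: prod.split)

lemma gromov_prod_cayley_near:
  assumes "w \<in> cayley_points G S" "p \<in> cayley_points G S" "q \<in> cayley_points G S"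
  shows "\<bar>gromov_prod cd w p q - gromov_prod d (fst w) (fst p) (fst q)\<bar> \<le> 3"
  using cayley_dist_near_word_dist[OF assms(2,1)] cayley_dist_near_word_dist[OF assms(3,1)]
    cayley_dist_near_word_dist[OF assms(2,3)]
  by (simp add: gromov_prod_def abs_le_iff field_simps)

lemma trans_length_S_le:
  assumes "a \<in> carrier G" "g \<in> carrier G"
  shows "trans_length_S G S a \<le> d g (a \<otimes> g) + 2"
proof -
  let ?D = "{cd y (cayley_act G a y) | y. y \<in> cayley_points G S}"
  have near: "\<bar>cd y (cayley_act G a y) - d (fst y) (a \<otimes> fst y)\<bar> \<le> 2" if "y \<in> cayley_points G S" for y
    using cayley_dist_near_word_dist[OF that cayley_act_point[OF assms(1) that]] by simp
  have "bdd_below ?D"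
  proof (rule bdd_belowI[of _ "- 2"])
    fix x assume "x \<in> ?D"
    then obtain y where y: "y \<in> cayley_points G S" "x = cd y (cayley_act G a y)" by blast
    show "- 2 \<le> x" using near[OF y(1)] d_nonneg[of "fst y" "a \<otimes> fst y"] unfolding y(2) by linarith
  qed
  moreover have "cd (cayley_vertex G g) (cayley_act G a (cayley_vertex G g)) \<in> ?D"
    using cayley_vertex_point[OF assms(2)] by blast
  ultimately have "trans_length_S G S a \<le> cd (cayley_vertex G g) (cayley_act G a (cayley_vertex G g))"
    unfolding trans_length_S_def by (intro cInf_lower)
  also have "\<dots> \<le> d g (a \<otimes> g) + 2" using near[OF cayley_vertex_point[OF assms(2)]] by simp
  finally show ?thesis .
qed

lemma trans_length_S_nonneg:
  assumes "a \<in> carrier G"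
  shows "0 \<le> trans_length_S G S a"
  unfolding trans_length_S_def
proof (rule cInf_greatest)
  show "{cd y (cayley_act G a y) | y. y \<in> cayley_points G S} \<noteq> {}" using cayley_vertex_point[of \<one>] by blast
qed (use cayley_dist_nonneg cayley_act_point[OF assms] in blast)

lemma trans_length_S_ge:
  assumes "a \<in> carrier G" "\<And>g. g \<in> carrier G \<Longrightarrow> r \<le> d g (a \<otimes> g)"
  shows "r - 2 \<le> trans_length_S G S a"
  unfolding trans_length_S_def
proof (rule cInf_greatest)
  show "{cd y (cayley_act G a y) | y. y \<in> cayley_points G S} \<noteq> {}" using cayley_vertex_point[of \<one>] by blast
  fix x assume "x \<in> {cd y (cayley_act G a y) | y. y \<in> cayley_points G S}"
  then obtain y where y: "y \<in> cayley_points G S" "x = cd y (cayley_act G a y)" by blast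
  then show "r - 2 \<le> x"
    using cayley_dist_near_word_dist[OF y(1) cayley_act_point[OF assms(1) y(1)]] assms(2)[OF cayley_pointsE(1)[OF y(1)]]
    by simp
qed

text \<open>Edges are labelled by S only, so a step whose label lies outside S is traversed
  backwards along the inverse generator. A vertex of the path may then be encoded at parameter 0 or
  at parameter 1, which the last conclusion records.\<close>

lemma cayley_geodesic_of_vertices:
  fixes \<gamma> :: "int \<Rightarrow> 'a"
  assumes c\<gamma>: "\<And>t. \<gamma> t \<in> carrier G" and iso: "\<And>s t. d (\<gamma> s) (\<gamma> t) = real_of_int \<bar>s - t\<bar>"
  obtains c where "cayley_geodesic G S c" "\<And>t. fst (c t) = \<gamma> \<lfloor>t\<rfloor> \<or> fst (c t) = \<gamma> (\<lfloor>t\<rfloor> + 1)"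
    "\<And>n::int. \<exists>s\<in>S. c (real_of_int n) = (\<gamma> n, s, 0) \<or> c (real_of_int n) = (\<gamma> n \<otimes> inv s, s, 1)"
proof -
  define s where "s n = inv \<gamma> n \<otimes> \<gamma> (n + 1)" for n
  have sc: "s n \<in> carrier G" for n using c\<gamma> by (simp add: s_def)
  have sg: "\<gamma> n \<otimes> s n = \<gamma> (n + 1)" "\<gamma> (n + 1) \<otimes> inv (s n) = \<gamma> n" for n
    using c\<gamma> by (simp_all add: s_def inv_mult_group)
  have sS: "inv (s n) \<in> S" if "s n \<notin> S" for n
  proof -
    have "real (N (s n)) = 1" using iso[of n "n + 1"] by (simp add: word_dist_def s_def)
    then show ?thesis using N_one_cases[OF sc, of n] that by simp
  qed
  have inj: "i = j" if "\<gamma> i = \<gamma> j" for i j using iso[of i j] that c\<gamma> by simp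
  define c where "c t = (if s \<lfloor>t\<rfloor> \<in> S then (\<gamma> \<lfloor>t\<rfloor>, s \<lfloor>t\<rfloor>, t - \<lfloor>t\<rfloor>)
    else (\<gamma> (\<lfloor>t\<rfloor> + 1), inv (s \<lfloor>t\<rfloor>), 1 - (t - \<lfloor>t\<rfloor>)))" for t :: real
  have pts: "c t \<in> cayley_points G S" for t
    using c\<gamma> sS by (auto simp: c_def cayley_points_def) linarith+
  have ends: "cayley_ends G (c t) = {(\<gamma> \<lfloor>t\<rfloor>, \<bar>t - \<lfloor>t\<rfloor>\<bar>), (\<gamma> (\<lfloor>t\<rfloor> + 1), \<bar>t - (\<lfloor>t\<rfloor> + 1)\<bar>)}" for t
  proof -
    have "\<bar>t - \<lfloor>t\<rfloor>\<bar> = t - \<lfloor>t\<rfloor>" "\<bar>t - (\<lfloor>t\<rfloor> + 1)\<bar> = 1 - (t - \<lfloor>t\<rfloor>)" by linarith+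
    then show ?thesis by (auto simp: c_def cayley_ends_def sg)
  qed
  \<comment> \<open>Two points share an edge label only within the same unit interval: \<gamma> is
    injective, and exchanged endpoints would give contradictory floors.\<close>
  have edge: "\<lfloor>t\<rfloor> = \<lfloor>t'\<rfloor> \<and> \<bar>snd (snd (c t)) - snd (snd (c t'))\<bar> = \<bar>t - t'\<bar>"
    if "fst (c t) = fst (c t')" "fst (snd (c t)) = fst (snd (c t'))" for t t'
  proof -
    have other: "fst (c t) = \<gamma> \<lfloor>t\<rfloor> \<and> fst (c t) \<otimes> fst (snd (c t)) = \<gamma> (\<lfloor>t\<rfloor> + 1) \<or>
        fst (c t) = \<gamma> (\<lfloor>t\<rfloor> + 1) \<and> fst (c t) \<otimes> fst (snd (c t)) = \<gamma> \<lfloor>t\<rfloor>" for t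
      by (simp add: c_def sg)
    have "\<gamma> \<lfloor>t\<rfloor> = \<gamma> \<lfloor>t'\<rfloor> \<or> \<gamma> \<lfloor>t\<rfloor> = \<gamma> (\<lfloor>t'\<rfloor> + 1) \<and> \<gamma> (\<lfloor>t\<rfloor> + 1) = \<gamma> \<lfloor>t'\<rfloor> \<or>
        \<gamma> (\<lfloor>t\<rfloor> + 1) = \<gamma> (\<lfloor>t'\<rfloor> + 1)"
      using other[of t] other[of t'] that by metis
    then have "\<lfloor>t\<rfloor> = \<lfloor>t'\<rfloor> \<or> \<lfloor>t\<rfloor> = \<lfloor>t'\<rfloor> + 1 \<and> \<lfloor>t\<rfloor> + 1 = \<lfloor>t'\<rfloor> \<or> \<lfloor>t\<rfloor> + 1 = \<lfloor>t'\<rfloor> + 1"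
      using inj by meson
    then have "\<lfloor>t\<rfloor> = \<lfloor>t'\<rfloor>" by linarith
    then show ?thesis using that by (auto simp: c_def)
  qed
  have "cd (c t) (c t') = \<bar>t - t'\<bar>" for t t'
    unfolding cayley_dist_eq
  proof (rule Min_eqI)
    let ?I = "\<lambda>t::real. {\<lfloor>t\<rfloor>, \<lfloor>t\<rfloor> + 1}"
    let ?E = "(\<lambda>((u, a), (v, b)). a + d u v + b) ` (cayley_ends G (c t) \<times> cayley_ends G (c t'))"
    have E: "cayley_ends G (c t) = (\<lambda>i. (\<gamma> i, \<bar>t - of_int i\<bar>)) ` ?I t" for t
      unfolding ends by simp
    have E': "?E = (\<lambda>(i, j). \<bar>t - of_int i\<bar> + real_of_int \<bar>i - j\<bar> + \<bar>t' - of_int j\<bar>) ` (?I t \<times> ?I t')"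
      unfolding E by (force simp: iso)
    show "finite (?E \<union> (if fst (c t) = fst (c t') \<and> fst (snd (c t)) = fst (snd (c t'))
        then {\<bar>snd (snd (c t)) - snd (snd (c t'))\<bar>} else {}))"
      using finite_cayley_ends by auto
    show "\<bar>t - t'\<bar> \<le> y" if "y \<in> ?E \<union> (if fst (c t) = fst (c t') \<and> fst (snd (c t)) = fst (snd (c t'))
        then {\<bar>snd (snd (c t)) - snd (snd (c t'))\<bar>} else {})" for y
    proof (cases "y \<in> ?E")
      case True
      then obtain ij :: "int \<times> int" where
        "y = (case ij of (i, j) \<Rightarrow> \<bar>t - of_int i\<bar> + real_of_int \<bar>i - j\<bar> + \<bar>t' - of_int j\<bar>)"
        unfolding E' by blast
      then obtain i j :: int where "y = \<bar>t - of_int i\<bar> + real_of_int \<bar>i - j\<bar> + \<bar>t' - of_int j\<bar>"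
        by (cases ij) (simp only: prod.case)
      then show ?thesis by linarith
    next
      case False
      then show ?thesis using that edge[of t t'] by (auto split: if_splits)
    qed
    show "\<bar>t - t'\<bar> \<in> ?E \<union> (if fst (c t) = fst (c t') \<and> fst (snd (c t)) = fst (snd (c t'))
        then {\<bar>snd (snd (c t)) - snd (snd (c t'))\<bar>} else {})"
    proof (cases "\<lfloor>t\<rfloor> = \<lfloor>t'\<rfloor>")
      case True
      then have "fst (c t) = fst (c t')" "fst (snd (c t)) = fst (snd (c t'))" by (simp_all add: c_def)
      then show ?thesis using edge[of t t'] by simp
    next
      case False
      \<comment> \<open>A shortest route leaves each unit interval through the end that faces the
        other point.\<close>
      have "\<exists>i\<in>?I t. \<exists>j\<in>?I t'. \<bar>t - t'\<bar> = \<bar>t - of_int i\<bar> + real_of_int \<bar>i - j\<bar> + \<bar>t' - of_int j\<bar>"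
      proof (cases "\<lfloor>t\<rfloor> < \<lfloor>t'\<rfloor>")
        case True
        then have "\<bar>t - t'\<bar> = \<bar>t - of_int (\<lfloor>t\<rfloor> + 1)\<bar> + real_of_int \<bar>(\<lfloor>t\<rfloor> + 1) - \<lfloor>t'\<rfloor>\<bar> + \<bar>t' - of_int \<lfloor>t'\<rfloor>\<bar>"
          by linarith
        then show ?thesis by blast
      next
        case 2: False
        then have "\<bar>t - t'\<bar> = \<bar>t - of_int \<lfloor>t\<rfloor>\<bar> + real_of_int \<bar>\<lfloor>t\<rfloor> - (\<lfloor>t'\<rfloor> + 1)\<bar> + \<bar>t' - of_int (\<lfloor>t'\<rfloor> + 1)\<bar>"
          using False by linarith
        then show ?thesis by blast
      qed
      then obtain i j where ij: "i \<in> ?I t" "j \<in> ?I t'"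
        "\<bar>t - t'\<bar> = \<bar>t - of_int i\<bar> + real_of_int \<bar>i - j\<bar> + \<bar>t' - of_int j\<bar>" by blast
      have "\<bar>t - t'\<bar> \<in> ?E"
        unfolding E' by (rule image_eqI[of _ _ "(i, j)"]) (use ij in \<open>simp_all only: prod.case mem_Sigma_iff\<close>)
      then show ?thesis by blast
    qed
  qed
  then have "cayley_geodesic G S c" using pts by (simp add: cayley_geodesic_def)
  moreover have "fst (c t) = \<gamma> \<lfloor>t\<rfloor> \<or> fst (c t) = \<gamma> (\<lfloor>t\<rfloor> + 1)" for t by (simp add: c_def)
  moreover have "\<exists>s\<in>S. c (real_of_int n) = (\<gamma> n, s, 0) \<or> c (real_of_int n) = (\<gamma> n \<otimes> inv s, s, 1)" for n
    using sS[of n] sg[of n] sc[of n] by (cases "s n \<in> S") (auto simp: c_def)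
  ultimately show ?thesis using that by blast
qed

end

lemma hyp_groupI:
  assumes "hyperbolic_group G S"
  obtains \<delta> where "hyp_group G S \<delta>"
proof -
  interpret group G using assms by (simp add: hyperbolic_group_def)
  interpret word_metric G S using assms by unfold_locales (auto simp: hyperbolic_group_def)
  obtain \<delta> where \<delta>: "0 \<le> \<delta>" and hyp: "\<And>w x y z. w \<in> cayley_points G S \<Longrightarrow> x \<in> cayley_points G S \<Longrightarrow>
      y \<in> cayley_points G S \<Longrightarrow> z \<in> cayley_points G S \<Longrightarrow>
      gromov_prod cd w x z \<ge> min (gromov_prod cd w x y) (gromov_prod cd w y z) - \<delta>"
    using assms unfolding hyperbolic_group_def gromov_hyperbolic_on_def by blast
  \<comment> \<open>Passing to vertices moves each side of the four-point inequality by at most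
    3.\<close>
  have "hyp_group G S (\<delta> + 6)"
  proof unfold_locales
    fix w x y z assume c: "w \<in> carrier G" "x \<in> carrier G" "y \<in> carrier G" "z \<in> carrier G"
    let ?v = "cayley_vertex G"
    note v = cayley_vertex_point
    show "gromov_prod d w x z \<ge> min (gromov_prod d w x y) (gromov_prod d w y z) - (\<delta> + 6)"
      using hyp[OF v[OF c(1)] v[OF c(2)] v[OF c(3)] v[OF c(4)]]
        gromov_prod_cayley_near[OF v[OF c(1)] v[OF c(2)] v[OF c(4)]]
        gromov_prod_cayley_near[OF v[OF c(1)] v[OF c(2)] v[OF c(3)]]
        gromov_prod_cayley_near[OF v[OF c(1)] v[OF c(3)] v[OF c(4)]]
      by (simp add: min_def abs_le_iff split: if_splits)
  qed (use \<delta> in simp)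
  then show ?thesis using that by blast
qed

section \<open>Isometric actions\<close>

lemma trans_length_le: "trans_length f \<le> dist x (f x)"
  unfolding trans_length_def by (rule cInf_lower) (auto intro!: bdd_belowI[of _ 0])

lemma trans_length_ge: "(\<And>x. r \<le> dist x (f x)) \<Longrightarrow> r \<le> trans_length f"
  unfolding trans_length_def by (rule cInf_greatest) auto

lemma orbit_edge_data_exists:
  assumes "geodesic_space TYPE('x::metric_space)"
  obtains \<sigma> where "orbit_edge_data S \<rho> (x :: 'x) \<sigma>"
proof -
  have "\<exists>c. c 0 = x \<and> c (dist x y) = y \<and>
      (\<forall>s\<in>{0..dist x y}. \<forall>t\<in>{0..dist x y}. dist (c s) (c t) = \<bar>s - t\<bar>)" for y :: 'x
    using assms unfolding geodesic_space_def by blast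
  then obtain c where c: "\<And>y. c y 0 = x" "\<And>y. c y (dist x y) = y"
    "\<And>y s t. s \<in> {0..dist x y} \<Longrightarrow> t \<in> {0..dist x y} \<Longrightarrow> dist (c y s) (c y t) = \<bar>s - t\<bar>"
    by metis
  define \<sigma> where "\<sigma> s u = c (\<rho> s x) (u * dist x (\<rho> s x))" for s u
  have "dist (\<sigma> s u) (\<sigma> s v) = \<bar>u - v\<bar> * dist x (\<rho> s x)" if "u \<in> {0..1}" "v \<in> {0..1}" for s u v
  proof -
    have "u * dist x (\<rho> s x) \<in> {0..dist x (\<rho> s x)}" "v * dist x (\<rho> s x) \<in> {0..dist x (\<rho> s x)}"
      using that by (auto intro: mult_left_le_one_le)
    then have "dist (\<sigma> s u) (\<sigma> s v) = \<bar>u * dist x (\<rho> s x) - v * dist x (\<rho> s x)\<bar>"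
      unfolding \<sigma>_def by (rule c(3))
    also have "\<dots> = \<bar>u - v\<bar> * dist x (\<rho> s x)" by (simp add: abs_mult flip: left_diff_distrib)
    finally show ?thesis .
  qed
  then have "orbit_edge_data S \<rho> x \<sigma>" using c(1,2) by (simp add: orbit_edge_data_def \<sigma>_def)
  then show ?thesis using that by blast
qed

context word_metric
begin

context
  fixes \<rho> :: "'a \<Rightarrow> 'x::metric_space \<Rightarrow> 'x"
  assumes rep: "isom_rep G \<rho>"
begin

lemma rep_dist: "g \<in> carrier G \<Longrightarrow> dist (\<rho> g x) (\<rho> g y) = dist x y"
  using rep by (simp add: isom_rep_def isometry_def)

lemma rep_mult: "g \<in> carrier G \<Longrightarrow> h \<in> carrier G \<Longrightarrow> \<rho> (g \<otimes> h) x = \<rho> g (\<rho> h x)"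
  using rep by (simp add: isom_rep_def)

text \<open>By multiplicativity, \<open>\<rho> \<one>\<close> is an idempotent isometry, hence the
  identity.\<close>

lemma rep_one: "\<rho> \<one> x = x"
  using rep_dist[of \<one> "\<rho> \<one> x" x] rep_mult[of \<one> \<one> x] by simp

lemma rep_dist_eq:
  assumes "g \<in> carrier G" "h \<in> carrier G"
  shows "dist (\<rho> g x) (\<rho> h x) = dist x (\<rho> (inv g \<otimes> h) x)"
  using rep_dist[of g x "\<rho> (inv g \<otimes> h) x"] rep_mult[of g "inv g \<otimes> h" x] assms by simp

lemma rep_dist_mult:
  assumes "g \<in> carrier G" "h \<in> carrier G"
  shows "dist x (\<rho> (g \<otimes> h) x) \<le> dist x (\<rho> g x) + dist x (\<rho> h x)"
  using dist_triangle[of x "\<rho> g (\<rho> h x)" "\<rho> g x"] rep_dist[OF assms(1), of x "\<rho> h x"] rep_mult[OF assms] by simp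

lemma rep_dist_inv:
  assumes "g \<in> carrier G" shows "dist x (\<rho> (inv g) x) = dist x (\<rho> g x)"
  using rep_dist_eq[of g \<one> x] assms by (simp add: rep_one dist_commute)

text \<open>The points x and y are kept apart because x stays the base point of the orbit map while
  y runs over all of X in the infimum.\<close>

lemma rep_dist_pow:
  assumes "a \<in> carrier G"
  shows "dist x (\<rho> (a [^] (n::nat)) x) \<le> real n * dist y (\<rho> a y) + 2 * dist x y"
proof -
  have "dist y (\<rho> (a [^] n) y) \<le> real n * dist y (\<rho> a y)"
  proof (induction n)
    case (Suc n)
    then show ?case using rep_dist_mult[of "a [^] n" a y] assms by (simp add: algebra_simps)
  qed (simp add: rep_one)
  moreover have "dist x (\<rho> (a [^] n) x) \<le> dist x y + (dist y (\<rho> (a [^] n) y) + dist (\<rho> (a [^] n) y) (\<rho> (a [^] n) x))"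
    by (meson add_left_mono dist_triangle order_trans)
  moreover have "dist (\<rho> (a [^] n) y) (\<rho> (a [^] n) x) = dist x y"
    using rep_dist[of "a [^] n" y x] assms by (simp add: dist_commute)
  ultimately show ?thesis by linarith
qed

lemma orbit_lipschitz:
  obtains M where "1 \<le> M" "\<And>s. s \<in> S \<Longrightarrow> dist x (\<rho> s x) \<le> M"
    "\<And>g h. g \<in> carrier G \<Longrightarrow> h \<in> carrier G \<Longrightarrow> dist (\<rho> g x) (\<rho> h x) \<le> M * d g h"
proof -
  \<comment> \<open>A sum is an upper bound even for empty S, and the summand 1 ensures
    \<open>1 \<le> M\<close>.\<close>
  define M where "M = 1 + (\<Sum>s\<in>S. dist x (\<rho> s x))"
  have M1: "1 \<le> M" by (simp add: M_def sum_nonneg)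
  have MS: "dist x (\<rho> s x) \<le> M" if "s \<in> S" for s
    using member_le_sum[OF that, of "\<lambda>s. dist x (\<rho> s x)"] fin_S by (simp add: M_def)
  have word: "dist x (\<rho> (eval_word G w) x) \<le> M * length w" if "is_word w" for w
    using that
  proof (induction w)
    case (Cons p w)
    obtain s b where p: "p = (s, b)" by (cases p)
    have s: "s \<in> S" "s \<in> carrier G" "is_word w" using Cons p S_carrier by auto
    define e where "e = (if b then s else inv s)"
    have e: "dist x (\<rho> e x) \<le> M" "e \<in> carrier G" using MS[OF s(1)] rep_dist_inv[OF s(2), of x] s(2) by (simp_all add: e_def)
    have "eval_word G (p # w) = e \<otimes> eval_word G w" by (simp add: p e_def eval_word_Cons)
    then show ?case
      using rep_dist_mult[OF e(2) is_word_carrier[OF s(3)], of x] Cons.IH[OF s(3)] e(1) by (simp add: algebra_simps)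
  qed (simp add: eval_word_Nil rep_one)
  have "dist (\<rho> g x) (\<rho> h x) \<le> M * d g h" if gh: "g \<in> carrier G" "h \<in> carrier G" for g h
  proof -
    obtain w where "length w = N (inv g \<otimes> h)" "is_word w" "eval_word G w = inv g \<otimes> h"
      using N_word[of "inv g \<otimes> h"] gh by auto
    then show ?thesis using word[of w] rep_dist_eq[OF gh] by (simp add: word_dist_def)
  qed
  then show ?thesis using that M1 MS by blast
qed

lemma orbit_map_near:
  assumes \<sigma>: "orbit_edge_data S \<rho> x \<sigma>" and M: "0 \<le> M" "\<And>s. s \<in> S \<Longrightarrow> dist x (\<rho> s x) \<le> M"
    and p: "p \<in> cayley_points G S"
  shows "dist (orbit_map \<rho> x \<sigma> p) (\<rho> (fst p) x) \<le> M"
proof -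
  obtain g s t where pe: "p = (g, s, t)" by (cases p)
  show ?thesis
  proof (cases "t = 0")
    case True
    then show ?thesis using pe M by (simp add: orbit_map_def)
  next
    case False
    \<comment> \<open>\<open>t \<noteq> 0\<close> rules out the encoding of a vertex with label
      \<open>\<one>\<close>, where \<sigma> may be arbitrary.\<close>
    then have c: "g \<in> carrier G" "s \<in> S" "0 \<le> t" "t \<le> 1" using p pe by (auto simp: cayley_points_def)
    then have *: "\<sigma> s 0 = x"
      "\<forall>u\<in>{0..1}. \<forall>v\<in>{0..1}. dist (\<sigma> s u) (\<sigma> s v) = \<bar>u - v\<bar> * dist x (\<rho> s x)"
      using \<sigma> unfolding orbit_edge_data_def by auto
    have "dist (orbit_map \<rho> x \<sigma> p) (\<rho> (fst p) x) = dist (\<sigma> s t) (\<sigma> s 0)"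
      using False pe rep_dist[OF c(1)] *(1) by (simp add: orbit_map_def)
    also have "\<dots> = t * dist x (\<rho> s x)" using *(2)[THEN bspec, THEN bspec, of t 0] c by simp
    also have "\<dots> \<le> dist x (\<rho> s x)" using c by (simp add: mult_left_le_one_le)
    finally show ?thesis using M(2)[OF c(2)] by simp
  qed
qed

lemma orbit_map_at_vertex:
  assumes \<sigma>: "orbit_edge_data S \<rho> x \<sigma>" and g: "g \<in> carrier G" "s \<in> S"
  shows "orbit_map \<rho> x \<sigma> (g, s, 0) = \<rho> g x" "orbit_map \<rho> x \<sigma> (g \<otimes> inv s, s, 1) = \<rho> g x"
proof -
  have "\<sigma> s 1 = \<rho> s x" "s \<in> carrier G" using \<sigma> g S_carrier by (auto simp: orbit_edge_data_def)
  then show "orbit_map \<rho> x \<sigma> (g \<otimes> inv s, s, 1) = \<rho> g x"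
    using rep_mult[of "g \<otimes> inv s" s x] g by (simp add: orbit_map_def m_assoc)
qed (simp add: orbit_map_def)

end

end

section \<open>Stability and displacement\<close>

context hyp_group
begin

lemma axis_in_L_S:
  assumes "lox a"
  obtains c \<gamma> R where "c \<in> L_S G S a" "\<And>t::int. \<gamma> t \<in> carrier G"
    "\<And>s t::int. d (\<gamma> s) (\<gamma> t) = real_of_int \<bar>s - t\<bar>"
    "\<And>m::nat. \<exists>t. d (\<gamma> t) (a [^] m) \<le> R"
    "\<And>n::int. \<exists>s\<in>S. c (real_of_int n) = (\<gamma> n, s, 0) \<or> c (real_of_int n) = (\<gamma> n \<otimes> inv s, s, 1)"
proof -
  have a: "a \<in> carrier G" using assms lox_carrier by blast
  obtain \<gamma> :: "int \<Rightarrow> 'a" and R :: real where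
    \<gamma>: "\<And>t. \<gamma> t \<in> carrier G" "\<And>s t. d (\<gamma> s) (\<gamma> t) = real_of_int \<bar>s - t\<bar>"
    and near: "\<And>m::nat. \<exists>t. d (\<gamma> t) (a [^] m) \<le> R"
    and fwd: "\<And>t (m::nat). 0 \<le> t \<Longrightarrow> gp \<one> (\<gamma> t) (a [^] m) \<ge> min (real_of_int t) (real (N (a [^] m))) - R"
    and bwd: "\<And>t (m::nat). 0 \<le> t \<Longrightarrow> gp \<one> (\<gamma> (- t)) (inv a [^] m) \<ge> min (real_of_int t) (real (N (a [^] m))) - R"
    using lox_axis[OF assms] by blast
  obtain c where c: "cayley_geodesic G S c" "\<And>t. fst (c t) = \<gamma> \<lfloor>t\<rfloor> \<or> fst (c t) = \<gamma> (\<lfloor>t\<rfloor> + 1)"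
    "\<And>n::int. \<exists>s\<in>S. c (real_of_int n) = (\<gamma> n, s, 0) \<or> c (real_of_int n) = (\<gamma> n \<otimes> inv s, s, 1)"
    using cayley_geodesic_of_vertices[OF \<gamma>] by blast
  have cp: "c t \<in> cayley_points G S" for t using c(1) by (simp add: cayley_geodesic_def)
  obtain e where e: "0 < e" "\<And>n::nat. real (N (a [^] n)) \<ge> real n * e"
    using lox_growth_pos[OF assms] by blast
  have conv: "conv_to_pow G S (\<lambda>t. c (real_of_int s * t)) v"
    if v: "v \<in> carrier G" "s = 1 \<or> s = - 1"
      "\<And>t (m::nat). 0 \<le> t \<Longrightarrow> gp \<one> (\<gamma> (s * t)) (v [^] m) \<ge> min (real_of_int t) (real (N (a [^] m))) - R"
    for s :: int and v
    unfolding conv_to_pow_def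
  proof (rule allI)
    fix M :: real
    obtain n\<^sub>0 :: nat where n\<^sub>0: "real n\<^sub>0 * e > M + R + 3" using reals_Archimedean3[OF e(1)] by blast
    \<comment> \<open>Of the 4, 3 is for passing from the graph to vertices and 1 for rounding t to
      a vertex of the path. The 1 in the maximum keeps i nonnegative.\<close>
    define T where "T = max 1 (M + R + 4)"
    have "gromov_prod cd (cayley_vertex G \<one>) (c (real_of_int s * t)) (cayley_vertex G (v [^] n)) \<ge> M"
      if t: "T \<le> t" and n: "n\<^sub>0 \<le> n" for t and n :: nat
    proof -
      have "\<exists>i::int. fst (c (real_of_int s * t)) = \<gamma> (s * i) \<and> t - 1 \<le> real_of_int i"
      proof (cases "s = 1")
        case True
        have "t - 1 \<le> real_of_int \<lfloor>t\<rfloor>" "t - 1 \<le> real_of_int (\<lfloor>t\<rfloor> + 1)" by linarith+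
        then show ?thesis using c(2)[of t] unfolding True of_int_1 mult_1 by blast
      next
        case False
        then have s: "s = - 1" using v(2) by simp
        have "t - 1 \<le> real_of_int (- \<lfloor>- t\<rfloor>)" "t - 1 \<le> real_of_int (- (\<lfloor>- t\<rfloor> + 1))" by linarith+
        moreover have "s * - i = i" "real_of_int s * t = - t" for i by (simp_all add: s)
        ultimately show ?thesis using c(2)[of "- t"] by metis
      qed
      then obtain i :: int where i: "fst (c (real_of_int s * t)) = \<gamma> (s * i)" "t - 1 \<le> real_of_int i" by blast
      have "real n\<^sub>0 * e \<le> real n * e" using n e(1) by (intro mult_right_mono) auto
      then have "M + R + 3 < N (a [^] n)" using e(2)[of n] n\<^sub>0 by linarith
      moreover have "M + R + 3 \<le> real_of_int i" "0 \<le> i" using i(2) t by (auto simp: T_def)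
      ultimately have "M + 3 \<le> gp \<one> (\<gamma> (s * i)) (v [^] n)"
        using v(3)[of i n] by (simp add: min_def split: if_splits)
      then show ?thesis
        using gromov_prod_cayley_near[OF cayley_vertex_point[of \<one>] cp cayley_vertex_point[of "v [^] n"], of "real_of_int s * t"] i(1) v(1)
        by simp
    qed
    then show "\<exists>T n\<^sub>0. \<forall>t\<ge>T. \<forall>n\<ge>n\<^sub>0. gromov_prod cd (cayley_vertex G \<one>) (c (real_of_int s * t)) (cayley_vertex G (v [^] (n::nat))) \<ge> M"
      by blast
  qed
  have "c \<in> L_S G S a"
    using conv[of a 1] conv[of "inv a" "- 1"] fwd bwd a c(1) by (simp add: L_S_def)
  then show ?thesis using that[OF _ \<gamma> near c(3)] by blast
qed

section \<open>From stability to displacement\<close>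

lemma trans_length_S_bound_of_stable:
  fixes \<rho> :: "'a \<Rightarrow> 'x::metric_space \<Rightarrow> 'x"
  assumes rep: "isom_rep G \<rho>" and a: "a \<in> carrier G"
    and K: "1 \<le> K" and \<sigma>: "orbit_edge_data S \<rho> x \<sigma>"
    and qg: "infinite_order G a \<Longrightarrow> \<forall>c\<in>L_S G S a. quasi_geodesic K C (orbit_map \<rho> x \<sigma> \<circ> c)"
  shows "trans_length_S G S a \<le> K * dist y (\<rho> a y) + (3 + 7 * \<delta>)"
proof -
  let ?D = "dist y (\<rho> a y)"
  have "real (N (a [^] (2::nat))) \<le> real (N a) + 3 * \<delta> + K * ?D"
  proof (cases "lox a")
    case False
    moreover have "0 \<le> K * ?D" using K by simp
    ultimately show ?thesis using a by (simp add: lox_def)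
  next
    case True
    obtain c \<gamma> R where c: "c \<in> L_S G S a" and \<gamma>: "\<And>t::int. \<gamma> t \<in> carrier G"
      "\<And>s t::int. d (\<gamma> s) (\<gamma> t) = real_of_int \<bar>s - t\<bar>"
      and near: "\<And>m::nat. \<exists>t. d (\<gamma> t) (a [^] m) \<le> R"
      and vert: "\<And>n::int. \<exists>s\<in>S. c (real_of_int n) = (\<gamma> n, s, 0) \<or> c (real_of_int n) = (\<gamma> n \<otimes> inv s, s, 1)"
      using axis_in_L_S[OF True] by metis
    obtain M where M1: "1 \<le> M" and "\<And>s. s \<in> S \<Longrightarrow> dist x (\<rho> s x) \<le> M"
      and M2: "\<And>g h. g \<in> carrier G \<Longrightarrow> h \<in> carrier G \<Longrightarrow> dist (\<rho> g x) (\<rho> h x) \<le> M * d g h"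
      by (rule orbit_lipschitz[OF rep, where x = x]) (rule that)
    note M = M1 M2
    have om: "orbit_map \<rho> x \<sigma> (c (real_of_int n)) = \<rho> (\<gamma> n) x" for n
      using vert[of n] orbit_map_at_vertex[OF rep \<sigma> \<gamma>(1)] by auto
    have "quasi_geodesic K C (orbit_map \<rho> x \<sigma> \<circ> c)" using qg lox_infinite_order[OF True] c by blast
    then have qi: "real_of_int \<bar>s - t\<bar> / K - C \<le> dist (\<rho> (\<gamma> s) x) (\<rho> (\<gamma> t) x)" for s t
      unfolding quasi_geodesic_def comp_def using om by (metis of_int_abs of_int_diff)
    obtain t\<^sub>0 where t\<^sub>0: "d (\<gamma> t\<^sub>0) (a [^] (0::nat)) \<le> R" using near by blast
    define c\<^sub>0 where "c\<^sub>0 = K * (2 * dist x y + 2 * (M * R) + C) + 2 * R"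
    \<comment> \<open>\<open>c\<^sub>0\<close> collects all that depends on a and y apart from the
      rate. It disappears as n grows, so the resulting bound is uniform in a and y.\<close>
    have "real (N (a [^] n)) \<le> real n * (K * ?D) + c\<^sub>0" for n :: nat
    proof -
      obtain t where t: "d (\<gamma> t) (a [^] n) \<le> R" using near by blast
      have "dist (\<rho> (\<gamma> t\<^sub>0) x) x \<le> M * d (\<gamma> t\<^sub>0) \<one>" using M(2)[OF \<gamma>(1), of \<one> t\<^sub>0] rep_one[OF rep] by simp
      also have "\<dots> \<le> M * R" using t\<^sub>0 M(1) by (intro mult_left_mono) simp_all
      finally have 1: "dist (\<rho> (\<gamma> t\<^sub>0) x) x \<le> M * R" .
      have "dist (\<rho> (a [^] n) x) (\<rho> (\<gamma> t) x) \<le> M * d (\<gamma> t) (a [^] n)"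
        using M(2)[OF \<gamma>(1), of "a [^] n" t] a by (simp add: dist_commute)
      also have "\<dots> \<le> M * R" using t M(1) by (intro mult_left_mono) simp_all
      finally have 2: "dist (\<rho> (a [^] n) x) (\<rho> (\<gamma> t) x) \<le> M * R" .
      have "real_of_int \<bar>t\<^sub>0 - t\<bar> / K \<le> dist (\<rho> (\<gamma> t\<^sub>0) x) (\<rho> (\<gamma> t) x) + C" using qi[of t\<^sub>0 t] by simp
      also have "dist (\<rho> (\<gamma> t\<^sub>0) x) (\<rho> (\<gamma> t) x) \<le> dist (\<rho> (\<gamma> t\<^sub>0) x) x + dist x (\<rho> (a [^] n) x) + dist (\<rho> (a [^] n) x) (\<rho> (\<gamma> t) x)"
        using dist_triangle[of "\<rho> (\<gamma> t\<^sub>0) x" "\<rho> (\<gamma> t) x" x] dist_triangle[of x "\<rho> (\<gamma> t) x" "\<rho> (a [^] n) x"] by linarith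
      finally have "real_of_int \<bar>t\<^sub>0 - t\<bar> / K \<le> real n * ?D + 2 * dist x y + 2 * (M * R) + C"
        using 1 2 rep_dist_pow[OF rep a, of x n y] by linarith
      then have "real_of_int \<bar>t\<^sub>0 - t\<bar> \<le> K * (real n * ?D + 2 * dist x y + 2 * (M * R) + C)"
        using K by (simp add: divide_le_eq mult.commute)
      moreover have "real (N (a [^] n)) \<le> d \<one> (\<gamma> t\<^sub>0) + d (\<gamma> t\<^sub>0) (\<gamma> t) + d (\<gamma> t) (a [^] n)"
        using d_triangle[of \<one> "\<gamma> t\<^sub>0" "a [^] n"] d_triangle[of "\<gamma> t\<^sub>0" "\<gamma> t" "a [^] n"] \<gamma>(1) a by simp
      ultimately show ?thesis using t t\<^sub>0 \<gamma> by (simp add: c\<^sub>0_def algebra_simps)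
    qed
    then show ?thesis using linear_growth_imp_square[OF a, of "K * ?D" c\<^sub>0] K by simp
  qed
  \<comment> \<open>The constants add up as follows: 3\<delta> from the threshold of
    \<open>lox\<close>, 1 + 4\<delta> from the midpoint argument, and finally 2 for the passage to
    the Cayley graph.\<close>
  then have "\<exists>g\<in>carrier G. d g (a \<otimes> g) \<le> 1 + (3 * \<delta> + K * ?D) + 4 * \<delta>"
    using K delta_nonneg by (intro small_displacement[OF a]) auto
  then obtain g where "g \<in> carrier G" "d g (a \<otimes> g) \<le> 1 + (3 * \<delta> + K * ?D) + 4 * \<delta>" by blast
  then show ?thesis using trans_length_S_le[OF a, of g] by simp
qed

text \<open>Displacements are compared at the orbit points \<open>\<rho> g x\<close>, where g runs
  over the vertices, so the Lipschitz constant of one orbit suffices.\<close>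

lemma trans_length_le_trans_length_S:
  assumes rep: "isom_rep G \<rho>" and a: "a \<in> carrier G" and M: "1 \<le> M"
    "\<And>g h. g \<in> carrier G \<Longrightarrow> h \<in> carrier G \<Longrightarrow> dist (\<rho> g x) (\<rho> h x) \<le> M * d g h"
  shows "trans_length (\<rho> a) \<le> M * trans_length_S G S a + 2 * M"
proof -
  have "trans_length (\<rho> a) / M \<le> d g (a \<otimes> g)" if g: "g \<in> carrier G" for g
  proof -
    have "trans_length (\<rho> a) \<le> dist (\<rho> g x) (\<rho> (a \<otimes> g) x)"
      using trans_length_le[of "\<rho> a" "\<rho> g x"] rep_mult[OF rep a g] by simp
    also have "\<dots> \<le> M * d g (a \<otimes> g)" using M(2) g a by simp
    finally show ?thesis using M(1) by (simp add: divide_le_eq mult.commute)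
  qed
  then have "trans_length (\<rho> a) / M - 2 \<le> trans_length_S G S a" by (rule trans_length_S_ge[OF a])
  then have "trans_length (\<rho> a) / M \<le> trans_length_S G S a + 2" by simp
  then have "trans_length (\<rho> a) \<le> (trans_length_S G S a + 2) * M" using M(1) by (simp add: divide_le_eq)
  then show ?thesis by (simp add: algebra_simps)
qed

theorem stable_imp_well_displacing:
  fixes \<rho> :: "'a \<Rightarrow> 'x::metric_space \<Rightarrow> 'x"
  assumes rep: "isom_rep G \<rho>" and A: "A \<subseteq> carrier G" and stable: "A_stable G S A \<rho>"
  shows "A_well_displacing G S A \<rho>"
proof -
  obtain K C x \<sigma> where K: "1 \<le> K" and \<sigma>: "orbit_edge_data S \<rho> x \<sigma>"
    and qg: "\<And>a. a \<in> A \<Longrightarrow> infinite_order G a \<Longrightarrow> \<forall>c\<in>L_S G S a. quasi_geodesic K C (orbit_map \<rho> x \<sigma> \<circ> c)"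
    using stable unfolding A_stable_def by blast
  obtain M where M1: "1 \<le> M" and "\<And>s. s \<in> S \<Longrightarrow> dist x (\<rho> s x) \<le> M"
    and M2: "\<And>g h. g \<in> carrier G \<Longrightarrow> h \<in> carrier G \<Longrightarrow> dist (\<rho> g x) (\<rho> h x) \<le> M * d g h"
    by (rule orbit_lipschitz[OF rep, where x = x]) (rule that)
  note M = M1 M2
  define B where "B = 3 + 7 * \<delta> + 2 * M"
  have "trans_length_S G S a / (K * M) - B \<le> trans_length (\<rho> a) \<and>
      trans_length (\<rho> a) \<le> (K * M) * trans_length_S G S a + B" if "a \<in> A" for a
  proof
    have a: "a \<in> carrier G" using that A by blast
    note nonneg = trans_length_S_nonneg[OF a]
    have "(trans_length_S G S a - (3 + 7 * \<delta>)) / K \<le> trans_length (\<rho> a)"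
    proof (rule trans_length_ge)
      fix y
      show "(trans_length_S G S a - (3 + 7 * \<delta>)) / K \<le> dist y (\<rho> a y)"
        using trans_length_S_bound_of_stable[OF rep a K \<sigma> qg[OF that], of y] K by (simp add: divide_le_eq mult.commute)
    qed
    moreover have "trans_length_S G S a / (K * M) \<le> trans_length_S G S a / K"
      using K M(1) nonneg by (intro divide_left_mono) (auto simp: mult_le_cancel_left1)
    moreover have "(3 + 7 * \<delta>) / K \<le> 3 + 7 * \<delta>" using K delta_nonneg by (simp add: divide_le_eq mult_le_cancel_left1)
    ultimately show "trans_length_S G S a / (K * M) - B \<le> trans_length (\<rho> a)"
      using M(1) by (simp add: B_def diff_divide_distrib)
    have "M * trans_length_S G S a \<le> (K * M) * trans_length_S G S a"
      using K M(1) nonneg by (intro mult_right_mono) (auto simp: mult_le_cancel_right1)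
    then show "trans_length (\<rho> a) \<le> (K * M) * trans_length_S G S a + B"
      using trans_length_le_trans_length_S[OF rep a M] delta_nonneg by (simp add: B_def)
  qed
  moreover have "1 \<le> K * M" using mult_mono[of 1 K 1 M] K M(1) by simp
  moreover have "0 \<le> B" using delta_nonneg M(1) by (simp add: B_def)
  ultimately show ?thesis unfolding A_well_displacing_def by blast
qed

section \<open>From displacement to stability\<close>

text \<open>The Gromov product of \<open>c(t)\<close> and \<open>c(-t)\<close> is bounded, hence so is that of \<open>a\<^sup>n\<close> and its inverse.\<close>

lemma L_S_imp_lox_pow:
  assumes a: "a \<in> carrier G" "infinite_order G a" and c: "c \<in> L_S G S a"
  shows "\<exists>n::nat. lox (a [^] n)"
proof -
  have cp: "c t \<in> cayley_points G S" and ciso: "cd (c s) (c t) = \<bar>s - t\<bar>" for s t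
    using c by (simp_all add: L_S_def cayley_geodesic_def)
  \<comment> \<open>As c is geodesic, the product of \<open>c t\<close> and \<open>c (- t)\<close>
    at \<open>\<one>\<close>, rounded to vertices, is at most the length of the vertex of
    \<open>c 0\<close> plus 3; 2\<delta> is added for the chain to the powers of a.\<close>
  define B where "B = N (fst (c 0)) + 3 + 2 * \<delta>"
  have conv: "conv_to_pow G S c a" "conv_to_pow G S (\<lambda>t. c (- t)) (inv a)" using c by (simp_all add: L_S_def)
  obtain T n\<^sub>1 where 1: "\<And>t n. t \<ge> T \<Longrightarrow> n \<ge> n\<^sub>1 \<Longrightarrow>
      gromov_prod cd (cayley_vertex G \<one>) (c t) (cayley_vertex G (a [^] (n::nat))) \<ge> B + 4"
    using conv(1) unfolding conv_to_pow_def by blast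
  obtain T' n\<^sub>2 where 2: "\<And>t n. t \<ge> T' \<Longrightarrow> n \<ge> n\<^sub>2 \<Longrightarrow>
      gromov_prod cd (cayley_vertex G \<one>) (c (- t)) (cayley_vertex G (inv a [^] (n::nat))) \<ge> B + 4"
    using conv(2) unfolding conv_to_pow_def by blast
  define t where "t = max 0 (max T T')"
  have t: "0 \<le> t" "T \<le> t" "T' \<le> t" by (simp_all add: t_def)
  define p q o' where "p = fst (c t)" and "q = fst (c (- t))" and "o' = fst (c 0)"
  have pq: "p \<in> carrier G" "q \<in> carrier G" "o' \<in> carrier G"
    using cayley_pointsE(1)[OF cp] by (simp_all add: p_def q_def o'_def)
  have near: "\<bar>\<bar>s - t\<bar> - d (fst (c s)) (fst (c t))\<bar> \<le> 2" for s t
    using cayley_dist_near_word_dist[OF cp cp, of s t] ciso by simp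
  have "d p q \<ge> 2 * t - 2" "d p o' \<le> t + 2" "d q o' \<le> t + 2"
    using near[of t "- t"] near[of t 0] near[of "- t" 0] t(1) unfolding p_def q_def o'_def by linarith+
  moreover have "N p \<le> d p o' + N o'" "N q \<le> d q o' + N o'"
    using d_triangle[of p o' \<one>] d_triangle[of q o' \<one>] pq by simp_all
  ultimately have pq_small: "gp \<one> p q \<le> B - 2 * \<delta>"
    using pq by (simp add: gromov_prod_def B_def o'_def)
  obtain n where n: "max n\<^sub>1 n\<^sub>2 \<le> n" "real (N (a [^] n)) > 2 * B + 3 * \<delta>"
    using N_pow_unbounded[OF a] by blast
  let ?x = "a [^] n" and ?y = "inv a [^] n"
  have xy: "?x \<in> carrier G" "?y \<in> carrier G" using a by simp_all
  \<comment> \<open>Of the 4 in the choice of T, 3 is lost in passing to vertices; the remaining 1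
    keeps the coming contradiction strict.\<close>
  have px: "B + 1 \<le> gp \<one> p ?x"
    using 1[of t n] gromov_prod_cayley_near[OF cayley_vertex_point[of \<one>] cp[of t] cayley_vertex_point[OF xy(1)]] n(1)
    t(2) by (simp add: p_def)
  have qy: "B + 1 \<le> gp \<one> q ?y"
    using 2[of t n] gromov_prod_cayley_near[OF cayley_vertex_point[of \<one>] cp[of "- t"] cayley_vertex_point[OF xy(2)]] n(1)
    t(3) by (simp add: q_def)
  have "gp \<one> ?x ?y \<le> B"
  proof (rule ccontr)
    assume *: "\<not> ?thesis"
    define m where "m = min (B + 1) (gp \<one> ?x ?y)"
    have "m - 2 * \<delta> \<le> gp \<one> p q"
      using px qy pq xy gp_sym[of ?y q \<one>] by (intro hyp_ge2[of \<one> p ?x ?y q]) (auto simp: m_def)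
    moreover have "m > B" using * by (simp add: m_def)
    ultimately show False using pq_small by simp
  qed
  moreover have "d ?x ?y = N (?x [^] (2::nat))"
    using d_commute[OF xy] a xy by (simp add: word_dist_def nat_pow_inv numeral_2_eq_2)
  \<comment> \<open>A bounded product of \<open>a [^] n\<close> and its inverse means that squaring
    doubles the length up to 2B, and n was chosen with \<open>|a\<^sup>n|\<close> above 2B +
    3\<delta>.\<close>
  ultimately have "2 * real (N ?x) - real (N (?x [^] (2::nat))) \<le> 2 * B"
    using xy a by (simp add: gromov_prod_def N_pow_inv)
  then show ?thesis using n(2) xy unfolding lox_def by (intro exI[of _ n]) linarith
qed

text \<open>Both estimates of h f h^(-1) f' count h twice: it displaces every vertex by at least
  2|h| - C, and its image displaces x by at most twice what \<open>\<rho> h\<close> does, plus 2E.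
  Halving leaves the slope 1/J. That F is finite and independent of h makes E uniform.\<close>

lemma displacing_imp_orbit_expanding:
  fixes \<rho> :: "'a \<Rightarrow> 'x::metric_space \<Rightarrow> 'x"
  assumes rep: "isom_rep G \<rho>" and ne: "non_elementary G"
    and A: "subgroup A G" "\<forall>g\<in>carrier G. \<forall>a\<in>A. g \<otimes> a \<otimes> inv g \<in> A"
    and b: "lox b" "b \<in> A"
    and J: "1 \<le> J" and B: "0 \<le> B" "\<And>a. a \<in> A \<Longrightarrow> trans_length_S G S a / J - B \<le> trans_length (\<rho> a)"
  obtains C where "0 \<le> C"
    "\<And>g h. g \<in> carrier G \<Longrightarrow> h \<in> carrier G \<Longrightarrow> d g h / J - C \<le> dist (\<rho> g x) (\<rho> h x)"
proof -
  obtain F and C :: real where F: "finite F" "F \<subseteq> A" and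
    disp: "\<And>h. h \<in> carrier G \<Longrightarrow> \<exists>f\<in>F. \<exists>f'\<in>F. \<forall>x\<in>carrier G. d x (h \<otimes> f \<otimes> inv h \<otimes> f' \<otimes> x) \<ge> 2 * N h - C"
    by (rule normal_subgroup_displacement[OF b ne A]) (rule that)
  define E where "E = (\<Sum>f\<in>F. dist x (\<rho> f x))"
  have E: "dist x (\<rho> f x) \<le> E" if "f \<in> F" for f
    using member_le_sum[OF that, of "\<lambda>f. dist x (\<rho> f x)"] F(1) by (simp add: E_def)
  define D where "D = \<bar>C\<bar> + 2 + B + E"
  have E0: "0 \<le> E" by (simp add: E_def sum_nonneg)
  have D0: "0 \<le> D" using E0 B(1) by (simp add: D_def)
  have "N h / J - D \<le> dist x (\<rho> h x)" if h: "h \<in> carrier G" for h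
  proof -
    obtain f f' where f: "f \<in> F" "f' \<in> F"
      and big: "\<And>x. x \<in> carrier G \<Longrightarrow> d x (h \<otimes> f \<otimes> inv h \<otimes> f' \<otimes> x) \<ge> 2 * N h - C"
      using disp[OF h] by blast
    have fA: "f \<in> A" "f' \<in> A" using f F by auto
    have fc: "f \<in> carrier G" "f' \<in> carrier G" using fA subgroup.subset[OF A(1)] by auto
    let ?g = "h \<otimes> f \<otimes> inv h \<otimes> f'"
    have gA: "?g \<in> A" using bspec[OF bspec[OF A(2) h] fA(1)] fA(2) subgroup.m_closed[OF A(1)] by blast
    have gc: "?g \<in> carrier G" using h fc by simp
    have "(2 * N h - C) - 2 \<le> trans_length_S G S ?g" using big by (intro trans_length_S_ge[OF gc]) simp
    then have "((2 * N h - C) - 2) / J - B \<le> trans_length_S G S ?g / J - B" using J by (simp add: divide_right_mono)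
    also have "\<dots> \<le> trans_length (\<rho> ?g)" using B(2)[OF gA] .
    also have "\<dots> \<le> dist x (\<rho> ?g x)" by (rule trans_length_le)
    also have "\<dots> \<le> 2 * dist x (\<rho> h x) + 2 * E"
      using rep_dist_mult[OF rep, of "h \<otimes> f \<otimes> inv h" f' x] rep_dist_mult[OF rep, of "h \<otimes> f" "inv h" x]
        rep_dist_mult[OF rep, of h f x] rep_dist_inv[OF rep h, of x] E[OF f(1)] E[OF f(2)] h fc by simp
    finally have 1: "2 * (N h / J) - (C + 2) / J \<le> 2 * dist x (\<rho> h x) + 2 * E + B"
      by (simp add: diff_divide_distrib add_divide_distrib)
    have "(C + 2) / J \<le> (\<bar>C\<bar> + 2) / J" using J by (intro divide_right_mono) auto
    also have "\<dots> \<le> \<bar>C\<bar> + 2" using J by (simp add: divide_le_eq mult_le_cancel_left1)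
    finally show ?thesis using 1 B(1) by (simp add: D_def)
  qed
  then have "d g h / J - D \<le> dist (\<rho> g x) (\<rho> h x)" if "g \<in> carrier G" "h \<in> carrier G" for g h
    using that rep_dist_eq[OF rep that] by (simp add: word_dist_def)
  then show ?thesis using that D0 by blast
qed

theorem well_displacing_imp_stable:
  fixes \<rho> :: "'a \<Rightarrow> 'x::metric_space \<Rightarrow> 'x"
  assumes rep: "isom_rep G \<rho>" and geo: "geodesic_space TYPE('x)" and ne: "non_elementary G"
    and A: "subgroup A G" "\<forall>g\<in>carrier G. \<forall>a\<in>A. g \<otimes> a \<otimes> inv g \<in> A"
    and wd: "A_well_displacing G S A \<rho>"
  shows "A_stable G S A \<rho>"
proof -
  fix x :: 'x
  obtain \<sigma> where \<sigma>: "orbit_edge_data S \<rho> x \<sigma>" using orbit_edge_data_exists[OF geo] .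
  show ?thesis
  proof (cases "\<exists>a\<in>A. infinite_order G a \<and> L_S G S a \<noteq> {}")
    case False
    \<comment> \<open>There is no geodesic to map, so any constants serve.\<close>
    then have "\<forall>a\<in>A. infinite_order G a \<longrightarrow> (\<forall>c\<in>L_S G S a. quasi_geodesic 1 0 (orbit_map \<rho> x \<sigma> \<circ> c))" by blast
    then show ?thesis unfolding A_stable_def using \<sigma> by (meson order_refl)
  next
    case True
    then obtain a c where a: "a \<in> A" "infinite_order G a" "c \<in> L_S G S a" by blast
    have ac: "a \<in> carrier G" using a subgroup.subset[OF A(1)] by blast
    obtain n :: nat where n: "lox (a [^] n)" using L_S_imp_lox_pow[OF ac a(2,3)] by blast
    have aA: "a [^] n \<in> A"
      by (induction n) (use A(1) a(1) in \<open>auto simp: subgroup.one_closed subgroup.m_closed\<close>)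
    obtain J B where J: "1 \<le> J" and B: "0 \<le> B" "\<And>a. a \<in> A \<Longrightarrow> trans_length_S G S a / J - B \<le> trans_length (\<rho> a)"
      using wd unfolding A_well_displacing_def by blast
    obtain C where C: "0 \<le> C"
      "\<And>g h. g \<in> carrier G \<Longrightarrow> h \<in> carrier G \<Longrightarrow> d g h / J - C \<le> dist (\<rho> g x) (\<rho> h x)"
      using displacing_imp_orbit_expanding[OF rep ne A n aA J B] by blast
    obtain M where M: "1 \<le> M" "\<And>s. s \<in> S \<Longrightarrow> dist x (\<rho> s x) \<le> M"
      "\<And>g h. g \<in> carrier G \<Longrightarrow> h \<in> carrier G \<Longrightarrow> dist (\<rho> g x) (\<rho> h x) \<le> M * d g h"
      by (rule orbit_lipschitz[OF rep, where x = x]) (rule that)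
    \<comment> \<open>Rounding \<open>c s\<close> and \<open>c t\<close> to vertices costs 2M in the
      orbit map and 2 in the distance. The latter becomes 2M in the upper bound, so 4M + 2 covers
      both bounds.\<close>
    have "quasi_geodesic (J * M) (C + 4 * M + 2) (orbit_map \<rho> x \<sigma> \<circ> c)" if "c \<in> L_S G S a" for a c
      unfolding quasi_geodesic_def comp_def
    proof (intro allI)
      fix s t
      have cp: "c u \<in> cayley_points G S" for u using that by (simp add: L_S_def cayley_geodesic_def)
      let ?g = "fst (c s)" and ?h = "fst (c t)" and ?o = "orbit_map \<rho> x \<sigma>"
      note gh = cayley_pointsE(1)[OF cp[of s]] cayley_pointsE(1)[OF cp[of t]]
      have dst: "\<bar>\<bar>s - t\<bar> - d ?g ?h\<bar> \<le> 2"
        using cayley_dist_near_word_dist[OF cp cp, of s t] that by (simp add: L_S_def cayley_geodesic_def)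
      have o: "dist (?o (c u)) (\<rho> (fst (c u)) x) \<le> M" for u
        using orbit_map_near[OF rep \<sigma> _ M(2) cp] M(1) by simp
      have o': "\<bar>dist (?o (c s)) (?o (c t)) - dist (\<rho> ?g x) (\<rho> ?h x)\<bar> \<le> 2 * M"
        using o[of s] o[of t] dist_triangle[of "?o (c s)" "?o (c t)" "\<rho> ?g x"]
          dist_triangle[of "\<rho> ?g x" "?o (c t)" "\<rho> ?h x"] dist_triangle[of "\<rho> ?g x" "\<rho> ?h x" "?o (c s)"]
          dist_triangle[of "?o (c s)" "\<rho> ?h x" "?o (c t)"]
        by (simp add: dist_commute abs_le_iff)
      have "\<bar>s - t\<bar> / (J * M) \<le> \<bar>s - t\<bar> / J"
        using J M(1) by (intro divide_left_mono) (auto simp: mult_le_cancel_left1)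
      also have "\<dots> \<le> (d ?g ?h + 2) / J" using dst J by (intro divide_right_mono) auto
      also have "\<dots> \<le> d ?g ?h / J + 2" using J by (simp add: add_divide_distrib divide_le_eq)
      finally have 1: "\<bar>s - t\<bar> / (J * M) - (C + 4 * M + 2) \<le> dist (?o (c s)) (?o (c t))"
        using C(2)[OF gh] o' M(1) by linarith
      have "M * d ?g ?h \<le> M * (\<bar>s - t\<bar> + 2)" using dst M(1) by (intro mult_left_mono) auto
      moreover have "M * \<bar>s - t\<bar> \<le> (J * M) * \<bar>s - t\<bar>"
        using J M(1) by (intro mult_right_mono) (auto simp: mult_le_cancel_right1)
      ultimately have 2: "dist (?o (c s)) (?o (c t)) \<le> (J * M) * \<bar>s - t\<bar> + (C + 4 * M + 2)"
        using M(3)[OF gh] o' C(1) by (simp add: distrib_left)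
      show "\<bar>s - t\<bar> / (J * M) - (C + 4 * M + 2) \<le> dist (?o (c s)) (?o (c t)) \<and>
          dist (?o (c s)) (?o (c t)) \<le> J * M * \<bar>s - t\<bar> + (C + 4 * M + 2)"
        using 1 2 by simp
    qed
    moreover have "1 \<le> J * M" using mult_mono[of 1 J 1 M] J M(1) by simp
    moreover have "0 \<le> C + 4 * M + 2" using C(1) M(1) by simp
    ultimately show ?thesis unfolding A_stable_def using \<sigma> by blast
  qed
qed

end

text \<open>Conjugation by g is one of the automorphisms under which A is invariant.\<close>

lemma characteristic_imp_conj_closed:
  assumes "group G" and A: "characteristic_subgroup A G" and g: "g \<in> carrier G" and a: "a \<in> A"
  shows "g \<otimes>\<^bsub>G\<^esub> a \<otimes>\<^bsub>G\<^esub> inv\<^bsub>G\<^esub> g \<in> A"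
proof -
  interpret group G by fact
  define \<phi> where "\<phi> x = g \<otimes>\<^bsub>G\<^esub> x \<otimes>\<^bsub>G\<^esub> inv\<^bsub>G\<^esub> g" for x
  have "\<phi> \<in> hom G G" using g by (auto simp: hom_def \<phi>_def m_assoc)
  moreover have "bij_betw \<phi> (carrier G) (carrier G)"
    using g by (intro bij_betwI[where g = "\<lambda>x. inv\<^bsub>G\<^esub> g \<otimes>\<^bsub>G\<^esub> x \<otimes>\<^bsub>G\<^esub> g"]) (auto simp: \<phi>_def m_assoc)
  ultimately have "\<phi> ` A = A" using A by (simp add: characteristic_subgroup_def iso_def)
  then show ?thesis using a by (auto simp: \<phi>_def)
qed

theorem mainTheorem2:
  fixes \<Gamma> :: "'g monoid" and S :: "'g set" and A :: "'g set"
    and \<rho> :: "'g \<Rightarrow> 'x::metric_space \<Rightarrow> 'x"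
  assumes "hyperbolic_group \<Gamma> S"
    and "non_elementary \<Gamma>"
    and "proper_space TYPE('x)"
    and "geodesic_space TYPE('x)"
    and "gromov_hyperbolic_on (UNIV :: 'x set) dist"
    and "characteristic_subgroup A \<Gamma>"
    and "isom_rep \<Gamma> \<rho>"
  shows "A_stable \<Gamma> S A \<rho> \<longleftrightarrow> A_well_displacing \<Gamma> S A \<rho>"
proof -
  obtain \<delta> where "hyp_group \<Gamma> S \<delta>" using hyp_groupI[OF assms(1)] .
  then interpret hyp_group \<Gamma> S \<delta> .
  have A: "subgroup A \<Gamma>" using assms(6) by (simp add: characteristic_subgroup_def)
  show ?thesis
    using stable_imp_well_displacing[OF assms(7) subgroup.subset[OF A]]
      well_displacing_imp_stable[OF assms(7,4,2) A] characteristic_imp_conj_closed[OF group_axioms assms(6)]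
    by blast
qed

end
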